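(* Let $N\ge1$ be an integer, let $q$ be a positive real number and let $s$ be a real number with $s\ne1$ and $s>-2N-1$. Then $$R_N(s,q)=(-1)^{N+1}\,4\,\frac{(s)_{2N+1}}{\pi^{2N+2}q^{2N+1}}\sum_{k=0}^\infty\frac{\Pi_{s+2N+1}((2k+1)\pi q)}{(2k+1)^{2N+2}}$$ and $$R_N(s,q)=\frac{E_{2N+1}(0)}{(2N+1)!}\frac{(s)_{2N+1}}{q^{2N+1}}\,\theta_N(s,q),$$ where $0<\theta_N(s,q)<1$ is a suitable number that depends on $s$, $q$ and $N$.
   Context: For $|\arg q|<\pi$, $\zeta_E(s,q)$ denotes the alternating Hurwitz zeta function, defined for $\mathrm{Re}(s)>0$ by $\zeta_E(s,q)=\sum_{n=0}^\infty \frac{(-1)^n}{(n+q)^s}$ (principal branches) and extended to an entire function of $s\in\mathbb C$ by analytic continuation. $E_n(x)$ are the Euler polynomials, $\frac{2e^{xt}}{e^t+1}=\sum_{n\ge0}E_n(x)\frac{t^n}{n!}$ for $|t|<\pi$. $(s)_k=s(s+1)\cdots(s+k-1)$, $(s)_0=1$. For an integer $N\ge1$ the remainder $R_N(s,q)$ is defined by the equality $$\zeta_E(s,q)=\frac12 q^{-s}-\frac12 q^{-s}\left(\sum_{k=0}^{N-1}\frac{E_{2k+1}(0)}{(2k+1)!}\frac{(s)_{2k+1}}{q^{2k+1}}+R_N(s,q)\right).$$ The function $\Pi_p(w)$ is defined by $$\Pi_p(w)=\frac{w^p}{2}\left(e^{\frac{\pi}{2}\mathrm i p}e^{\mathrm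 i w}\,\Gamma(1-p,we^{\frac{\pi}{2}\mathrm i})+e^{-\frac{\pi}{2}\mathrm i p}e^{-\mathrm i w}\,\Gamma(1-p,we^{-\frac{\pi}{2}\mathrm i})\right),$$ where $\Gamma(a,z)$ is the (upper) incomplete gamma function, $\Gamma(a,z)=\int_z^\infty t^{a-1}e^{-t}\,dt$ with its principal branch for $|\arg z|<\pi$. *)

theory Defs
  imports "HOL-Complex_Analysis.Complex_Analysis"
begin

text \<open>
  The description picks the entire function of \<open>s\<close> that continues the alternating
  series; it is unique by the identity theorem. The intended range of \<open>q\<close> is
  \<open>\<bar>arg q\<bar> < \<pi>\<close>, where none of the bases \<open>n + q\<close> vanishes.
\<close>

definition alt_hurwitz_zeta :: "complex \<Rightarrow> complex \<Rightarrow> complex" where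
  "alt_hurwitz_zeta s q =
     (THE f. f holomorphic_on UNIV \<and>
             (\<forall>z. Re z > 0 \<longrightarrow> (\<lambda>n. (-1) ^ n / (of_nat n + q) powr z) sums f z)) s"

text \<open>
  The generating function \<open>2 e\<^sup>x\<^sup>t / (e\<^sup>t + 1)\<close> is read as a formal power series
  in \<open>t\<close>; the lemma \<open>euler_poly_sums\<close> below recovers the analytic form.
\<close>

definition euler_poly :: "nat \<Rightarrow> complex \<Rightarrow> complex" where
  "euler_poly n x = fact n * fps_nth (2 * fps_exp x / (fps_exp 1 + 1)) n"

lemma exp_plus_1_nonzero:
  fixes t :: complex
  assumes "norm t < pi"
  shows "exp t + 1 \<noteq> 0"
proof
  assume "exp t + 1 = 0"
  then have "exp t = exp (\<i> * of_real pi)"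
    by (simp add: eq_neg_iff_add_eq_0)
  then obtain n :: int where n: "t = \<i> * of_real pi + (of_int (2 * n) * of_real pi) * \<i>"
    unfolding exp_eq by auto
  then have "t = \<i> * of_real (of_int (2 * n + 1) * pi)"
    by (simp add: algebra_simps)
  then have "norm t = \<bar>of_int (2 * n + 1)\<bar> * pi"
    by (simp only: norm_mult norm_of_real abs_mult norm_ii) simp
  moreover have "\<bar>2 * n + 1\<bar> \<ge> 1"
    by presburger
  then have "\<bar>of_int (2 * n + 1) :: real\<bar> \<ge> 1"
    by linarith
  ultimately have "norm t \<ge> pi"
    by (simp add: mult_le_cancel_right1)
  with assms show False by simp
qed

lemma euler_poly_sums:
  fixes t x :: complex
  assumes "norm t < pi"
  shows "(\<lambda>n. euler_poly n x * t ^ n / fact n) sums (2 * exp (x * t) / (exp t + 1))"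
proof -
  define F where "F = 2 * fps_exp x / (fps_exp 1 + 1 :: complex fps)"
  have num: "fps_conv_radius (2 * fps_exp x) = \<infinity>"
    using fps_conv_radius_mult[of 2 "fps_exp x"] by simp
  have den: "fps_conv_radius (fps_exp 1 + 1 :: complex fps) = \<infinity>"
    using fps_conv_radius_add[of "fps_exp 1" "1 :: complex fps"] by simp
  have den_eval: "eval_fps (fps_exp 1 + 1) z = exp z + 1" for z :: complex
    by (simp add: eval_fps_add)
  have nz: "eval_fps (fps_exp 1 + 1) z \<noteq> 0" if "z \<in> eball 0 (ereal pi)" for z :: complex
    using that exp_plus_1_nonzero[of z] by (simp add: den_eval in_eball_iff)
  have rad: "fps_conv_radius F \<ge> ereal pi"
    using fps_conv_radius_divide'[where f = "2 * fps_exp x" and g = "fps_exp 1 + 1" and r = "ereal pi", OF _ _ _ nz]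
    by (simp add: num den F_def)
  have "eval_fps F t = eval_fps (2 * fps_exp x) t / eval_fps (fps_exp 1 + 1) t"
    unfolding F_def using assms
    by (intro eval_fps_divide'[where r = "ereal pi", OF _ _ _ nz]) (simp_all add: num den)
  then have val: "eval_fps F t = 2 * exp (x * t) / (exp t + 1)"
    by (simp add: den_eval eval_fps_mult)
  have "ereal (norm t) < fps_conv_radius F"
    using rad assms by (simp add: less_le_trans[of "ereal (norm t)" "ereal pi"])
  then have "(\<lambda>n. fps_nth F n * t ^ n) sums eval_fps F t"
    by (rule sums_eval_fps)
  then show ?thesis
    unfolding val by (simp add: euler_poly_def F_def)
qed

text \<open>
  The path from \<open>z\<close> to \<open>\<infinity>\<close> is the horizontal ray \<open>t = z + u\<close>, \<open>u \<ge> 0\<close>. It avoids the cut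
  of \<open>t powr (a - 1)\<close> whenever \<open>\<bar>arg z\<bar> < \<pi>\<close>, so this is the principal branch.
\<close>

definition upper_inc_Gamma :: "complex \<Rightarrow> complex \<Rightarrow> complex" where
  "upper_inc_Gamma a z =
     (LBINT u:{0..}. (z + complex_of_real u) powr (a - 1) * exp (- (z + complex_of_real u)))"

definition Pi_term :: "complex \<Rightarrow> complex \<Rightarrow> complex" where
  "Pi_term p w = w powr p / 2 *
     (exp (of_real pi / 2 * \<i> * p) * exp (\<i> * w) *
        upper_inc_Gamma (1 - p) (w * exp (of_real pi / 2 * \<i>)) +
      exp (- (of_real pi / 2) * \<i> * p) * exp (- \<i> * w) *
        upper_inc_Gamma (1 - p) (w * exp (- (of_real pi / 2) * \<i>)))"

definition alt_zeta_remainder :: "nat \<Rightarrow> complex \<Rightarrow> complex \<Rightarrow> complex" where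
  "alt_zeta_remainder N s q =
     (THE R. alt_hurwitz_zeta s q = 1 / 2 * q powr (- s) - 1 / 2 * q powr (- s) *
        ((\<Sum>k<N. euler_poly (2 * k + 1) 0 / fact (2 * k + 1) *
                 (pochhammer s (2 * k + 1) / q ^ (2 * k + 1))) + R))"

lemma alt_hurwitz_zeta_conv_remainder:
  assumes "q \<noteq> 0"
  shows "alt_hurwitz_zeta s q = 1 / 2 * q powr (- s) - 1 / 2 * q powr (- s) *
        ((\<Sum>k<N. euler_poly (2 * k + 1) 0 / fact (2 * k + 1) *
                 (pochhammer s (2 * k + 1) / q ^ (2 * k + 1))) + alt_zeta_remainder N s q)"
proof -
  have "\<exists>!R. Z = 1 / 2 * a - 1 / 2 * a * (S + R)" if "a \<noteq> 0" for Z a S :: complex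
    using that by (intro ex1I[of _ "1 - 2 * Z / a - S"]) (auto simp: field_simps)
  from theI'[OF this, of "q powr (- s)"] show ?thesis
    unfolding alt_zeta_remainder_def using assms by simp
qed

end

theory Submission imports Defs begin

text \<open>
  For \<open>Re s > 0\<close> one has \<open>\<Gamma>(s) \<zeta>\<^sub>E(s, q) = \<integral> t\<^bsup>s-1\<^esup> e\<^bsup>-qt\<^esup> / (1 + e\<^bsup>-t\<^esup>) dt\<close> over the positive half-line, with
  \<open>1 / (1 + e\<^bsup>-t\<^esup>) = (1 + tanh (t/2)) / 2\<close>. Expanding each term of the partial fraction
  series \<open>tanh (t/2) = \<Sum>j. 4t / (t\<^sup>2 + a\<^sub>j\<^sup>2)\<close>, \<open>a\<^sub>j = (2j+1)\<pi>\<close>, geometrically up to order \<open>N\<close>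
  produces the Euler polynomial coefficients together with the exact remainder
  \<open>(-1)\<^sup>N t\<^bsup>2N+1\<^esup> h\<^sub>N(t)\<close>, \<open>h\<^sub>N(t) = \<Sum>j. 4 / (a\<^sub>j\<^bsup>2N\<^esup> (t\<^sup>2 + a\<^sub>j\<^sup>2))\<close>. Its contribution
  \<open>\<integral> t\<^bsup>s+2N\<^esup> e\<^bsup>-qt\<^esup> h\<^sub>N(t) dt\<close> is holomorphic for \<open>Re s > -2N-1\<close>, so these formulas continue
  \<open>\<zeta>\<^sub>E\<close> and give \<open>R\<^sub>N\<close>. By Fubini, \<open>\<Pi>\<^sub>p(a q)\<close> is the Laplace-type integral
  \<open>q\<^sup>p / \<Gamma>(p) \<integral> t\<^bsup>p-1\<^esup> e\<^bsup>-qt\<^esup> a\<^sup>2 / (t\<^sup>2 + a\<^sup>2) dt\<close>, so integrating \<open>h\<^sub>N\<close> termwise gives the series.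
  Finally \<open>0 < h\<^sub>N(t) < h\<^sub>N(0)\<close> for \<open>t > 0\<close>, so \<open>\<theta>\<close>, the mean of \<open>h\<^sub>N / h\<^sub>N(0)\<close> against a Gamma
  density, lies strictly between 0 and 1.
\<close>

section \<open>Partial fractions of tanh\<close>

text \<open>The zeros of \<open>cosh (t / 2)\<close>, that is the poles of
  \<open>tanh (t / 2)\<close>, are \<open>\<i> * odd_pi j\<close> and their conjugates.\<close>

definition odd_pi :: "nat \<Rightarrow> real" where
  "odd_pi j = (2 * real j + 1) * pi"

text \<open>The remainder function \<open>h_N\<close> of the geometric expansion. At
  \<open>t = 0\<close> it is, up to the sign \<open>(-1) ^ N\<close>, the Taylor coefficient of
  \<open>tanh (t / 2)\<close> of order \<open>2 * N + 1\<close>.\<close>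

definition tanh_tail :: "nat \<Rightarrow> real \<Rightarrow> real" where
  "tanh_tail N t = (\<Sum>j. 4 / (odd_pi j ^ (2 * N) * (t\<^sup>2 + (odd_pi j)\<^sup>2)))"

lemma odd_pi_ge: "odd_pi j \<ge> real j + 1"
proof -
  have "real j + 1 \<le> (2 * real j + 1) * 1" by simp
  also have "\<dots> \<le> odd_pi j"
    unfolding odd_pi_def using pi_gt3 by (intro mult_left_mono) auto
  finally show ?thesis .
qed

lemma odd_pi_ge_pi: "odd_pi j \<ge> pi"
  unfolding odd_pi_def by (simp add: algebra_simps)

lemma odd_pi_ge_1: "odd_pi j \<ge> 1"
  using odd_pi_ge[of j] by linarith

lemma odd_pi_pos [simp]: "odd_pi j > 0"
  using odd_pi_ge_1[of j] by linarith

lemma odd_pi_nonzero [simp]: "odd_pi j \<noteq> 0"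
  using odd_pi_pos[of j] by linarith

lemma odd_pi_denom_pos: "odd_pi j ^ (2 * N) * (t\<^sup>2 + (odd_pi j)\<^sup>2) > 0"
  by (intro mult_pos_pos zero_less_power add_nonneg_pos) auto

lemma tanh_term_le:
  "4 / (odd_pi j ^ (2 * N) * (t\<^sup>2 + (odd_pi j)\<^sup>2)) \<le> 4 / (odd_pi j ^ (2 * N) * (0\<^sup>2 + (odd_pi j)\<^sup>2))"
  by (intro divide_left_mono mult_left_mono mult_pos_pos odd_pi_denom_pos) auto

text \<open>Since \<open>odd_pi j\<close> is at least \<open>j + 1\<close>, hence at least 1, every
  denominator is at least \<open>(j + 1)^2\<close>, whatever \<open>N\<close> and \<open>t\<close>
  are.\<close>

lemma summable_tanh_tail:
  "summable (\<lambda>j. 4 / (odd_pi j ^ (2 * N) * (t\<^sup>2 + (odd_pi j)\<^sup>2)))"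
proof (rule summable_comparison_test')
  show "summable (\<lambda>j. 4 * inverse (real (Suc j) ^ 2))"
    by (intro summable_mult) (subst summable_Suc_iff, rule inverse_power_summable, simp)
  fix j
  have "real (Suc j) ^ 2 \<le> 1 * (t\<^sup>2 + (odd_pi j)\<^sup>2)"
    using power_mono[OF odd_pi_ge[of j], of 2] by (simp add: add_increasing add.commute[of _ 1])
  also have "\<dots> \<le> odd_pi j ^ (2 * N) * (t\<^sup>2 + (odd_pi j)\<^sup>2)"
    using odd_pi_ge_1[of j] by (intro mult_right_mono one_le_power) auto
  finally show "norm (4 / (odd_pi j ^ (2 * N) * (t\<^sup>2 + (odd_pi j)\<^sup>2))) \<le> 4 * inverse (real (Suc j) ^ 2)"
    using odd_pi_denom_pos[of j N t]
    by (simp add: field_simps del: of_nat_Suc)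
qed

lemma tanh_tail_pos: "tanh_tail N t > 0"
  unfolding tanh_tail_def using odd_pi_denom_pos
  by (intro suminf_pos summable_tanh_tail) auto

lemma tanh_tail_le: "tanh_tail N t \<le> tanh_tail N 0"
  unfolding tanh_tail_def by (intro suminf_le summable_tanh_tail tanh_term_le)

text \<open>One step of the geometric expansion, termwise:
  \<open>1/(t^2 + a^2) = 1/a^2 - t^2/(a^2 (t^2 + a^2))\<close>.\<close>

lemma tanh_tail_Suc: "tanh_tail N t = tanh_tail N 0 - t\<^sup>2 * tanh_tail (Suc N) t"
proof -
  have "4 / (odd_pi j ^ (2 * N) * (t\<^sup>2 + (odd_pi j)\<^sup>2)) =
        4 / (odd_pi j ^ (2 * N) * (0\<^sup>2 + (odd_pi j)\<^sup>2)) -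
        t\<^sup>2 * (4 / (odd_pi j ^ (2 * Suc N) * (t\<^sup>2 + (odd_pi j)\<^sup>2)))" for j
    using odd_pi_denom_pos[of j 0 t] by (simp add: divide_simps) (simp add: algebra_simps power2_eq_square)
  thus ?thesis
    unfolding tanh_tail_def
    by (simp only: suminf_diff[symmetric] suminf_mult summable_mult summable_tanh_tail)
qed

lemma tanh_tail_less:
  assumes "t \<noteq> 0"
  shows "tanh_tail N t < tanh_tail N 0"
  using tanh_tail_Suc[of N t] tanh_tail_pos[of "Suc N" t] assms by simp

section \<open>Partial fractions of tanh from the digamma function\<close>

lemma cos_ii_of_real: "cos (\<i> * complex_of_real x) = of_real (cosh x)"
  unfolding cos_exp_eq cosh_field_def
  by (simp add: exp_of_real[symmetric] mult.assoc[symmetric] add.commute)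

lemma sin_ii_of_real: "sin (\<i> * complex_of_real x) = \<i> * of_real (sinh x)"
  unfolding sin_exp_eq sinh_field_def
  by (simp add: exp_of_real[symmetric] mult.assoc[symmetric] divide_simps) (simp add: algebra_simps)

text \<open>The logarithmic derivative of the Gamma reflection formula gives
  \<open>Digamma (1 - z) - Digamma z = pi * cot (pi * z)\<close>. On the line
  \<open>Re z = 1/2\<close> the cotangent becomes a hyperbolic tangent, and the digamma series
  supplies the partial fractions.\<close>

lemma tanh_partial_fractions: "tanh (t / 2) = t * tanh_tail 0 t"
proof -
  define y where "y = t / (2 * pi)"
  define z where "z = 1 / 2 + \<i> * of_real y"
  have z: "z \<notin> \<int>\<^sub>\<le>\<^sub>0" "1 - z \<notin> \<int>\<^sub>\<le>\<^sub>0"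
    by (auto elim!: nonpos_Ints_cases simp: z_def complex_eq_iff)
  have z0: "z \<noteq> 0" "1 - z \<noteq> 0"
    using z by auto
  \<comment> \<open>The product is differentiated twice: by the product rule here, and as
    \<open>sin (pi * z) / pi\<close> next.\<close>
  have "((\<lambda>z. rGamma z * rGamma (1 - z)) has_field_derivative
          rGamma z * rGamma (1 - z) * (Digamma (1 - z) - Digamma z)) (at z)"
    using z by (auto intro!: derivative_eq_intros simp: algebra_simps)
  moreover have "((\<lambda>z. rGamma z * rGamma (1 - z)) has_field_derivative cos (of_real pi * z)) (at z)"
    unfolding rGamma_reflection_complex by (auto intro!: derivative_eq_intros)
  ultimately have "rGamma z * rGamma (1 - z) * (Digamma (1 - z) - Digamma z) = cos (of_real pi * z)"
    by (rule DERIV_unique)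
  hence main: "sin (of_real pi * z) * (Digamma (1 - z) - Digamma z) = of_real pi * cos (of_real pi * z)"
    unfolding rGamma_reflection_complex by (simp add: field_simps)
  have arg: "of_real pi * z = of_real pi / 2 + \<i> * of_real (t / 2)"
    by (simp add: z_def y_def field_simps)
  have "sin (of_real pi * z) = cos (\<i> * of_real (t / 2))"
    unfolding arg by (simp add: sin_add cos_of_real sin_of_real flip: of_real_divide)
  hence s: "sin (of_real pi * z) = of_real (cosh (t / 2))"
    by (simp only: cos_ii_of_real)
  have "cos (of_real pi * z) = - sin (\<i> * of_real (t / 2))"
    unfolding arg by (simp add: cos_add cos_of_real sin_of_real flip: of_real_divide)
  hence c: "cos (of_real pi * z) = - (\<i> * of_real (sinh (t / 2)))"
    by (simp only: sin_ii_of_real)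
  have "cosh (t / 2) \<noteq> 0"
    using cosh_real_pos[of "t / 2"] by linarith
  with main s c have psi: "Digamma z - Digamma (1 - z) = \<i> * of_real pi * of_real (tanh (t / 2))"
    by (simp add: tanh_def field_simps)
  \<comment> \<open>The logarithms in the two digamma limits cancel, which leaves the partial sums
    of a series.\<close>
  have "(\<lambda>m. (of_real (ln (real m)) - (\<Sum>n<m. inverse (z + of_nat n))) -
             (of_real (ln (real m)) - (\<Sum>n<m. inverse (1 - z + of_nat n))))
          \<longlonglongrightarrow> Digamma z - Digamma (1 - z)"
    by (intro tendsto_diff Digamma_LIMSEQ z0)
  hence "(\<lambda>n. inverse (1 - z + of_nat n) - inverse (z + of_nat n)) sums (Digamma z - Digamma (1 - z))"
    by (simp add: sums_def sum_subtractf)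
  also have "(\<lambda>n. inverse (1 - z + of_nat n) - inverse (z + of_nat n)) =
     (\<lambda>n. \<i> * of_real pi * of_real (t * (4 / (odd_pi n ^ (2 * 0) * (t\<^sup>2 + (odd_pi n)\<^sup>2)))))"
  proof
    fix n
    have nz: "1 - z + of_nat n \<noteq> 0" "z + of_nat n \<noteq> 0"
      by (auto simp: z_def complex_eq_iff)
    have "inverse (1 - z + of_nat n) - inverse (z + of_nat n) =
          (2 * z - 1) / ((1 - z + of_nat n) * (z + of_nat n))"
      using nz by (simp add: field_simps)
    also have "2 * z - 1 = \<i> * of_real (2 * y)"
      by (simp add: z_def)
    also have "(1 - z + of_nat n) * (z + of_nat n) = of_real ((real n + 1 / 2)\<^sup>2 + y\<^sup>2)"
      by (simp add: z_def complex_eq_iff power2_eq_square algebra_simps)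
    also have "(real n + 1 / 2)\<^sup>2 + y\<^sup>2 = (t\<^sup>2 + (odd_pi n)\<^sup>2) / (4 * pi\<^sup>2)"
      by (simp add: y_def odd_pi_def field_simps power2_eq_square)
    also have "\<i> * of_real (2 * y) / of_real \<dots> =
        \<i> * complex_of_real (2 * y / ((t\<^sup>2 + (odd_pi n)\<^sup>2) / (4 * pi\<^sup>2)))"
      by simp
    also have "2 * y / ((t\<^sup>2 + (odd_pi n)\<^sup>2) / (4 * pi\<^sup>2)) = 
        pi * (t * (4 / (odd_pi n ^ (2 * 0) * (t\<^sup>2 + (odd_pi n)\<^sup>2))))"
      using odd_pi_denom_pos[of n 0 t] by (simp add: y_def field_simps power2_eq_square)
    finally show "inverse (1 - z + of_nat n) - inverse (z + of_nat n) =
     \<i> * of_real pi * of_real (t * (4 / (odd_pi n ^ (2 * 0) * (t\<^sup>2 + (odd_pi n)\<^sup>2))))"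
      by (simp add: mult_ac)
  qed
  finally have "(\<lambda>n. \<i> * of_real pi * of_real (t * (4 / (odd_pi n ^ (2 * 0) * (t\<^sup>2 + (odd_pi n)\<^sup>2)))))
      sums (\<i> * of_real pi * complex_of_real (tanh (t / 2)))"
    unfolding psi .
  hence "(\<lambda>n. t * (4 / (odd_pi n ^ (2 * 0) * (t\<^sup>2 + (odd_pi n)\<^sup>2)))) sums tanh (t / 2)"
    by (subst (asm) sums_mult_iff) (simp_all only: sums_of_real_iff, simp_all)
  moreover have "(\<lambda>n. t * (4 / (odd_pi n ^ (2 * 0) * (t\<^sup>2 + (odd_pi n)\<^sup>2)))) sums (t * tanh_tail 0 t)"
    unfolding tanh_tail_def by (intro sums_mult summable_sums summable_tanh_tail)
  ultimately show ?thesis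
    by (rule sums_unique2)
qed

section \<open>Taylor coefficients of tanh and Euler polynomials at zero\<close>

lemma tanh_expansion:
  "tanh (t / 2) = (\<Sum>k<N. (-1) ^ k * tanh_tail k 0 * t ^ (2 * k + 1)) +
                  (-1) ^ N * t ^ (2 * N + 1) * tanh_tail N t"
proof (induction N)
  case 0
  show ?case by (simp add: tanh_partial_fractions)
next
  case (Suc N)
  show ?case
    \<comment> \<open>Applying \<open>tanh_tail_Suc\<close> to the last term splits off the next
      power of \<open>t\<close>, so the expansion is exact for every real \<open>t\<close>.\<close>
    unfolding Suc.IH by (subst tanh_tail_Suc[of N t]) (simp add: algebra_simps power2_eq_square)
qed

lemma tanh_tail_0_le: "tanh_tail N 0 \<le> tanh_tail 0 0 / pi ^ (2 * N)"
proof -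
  have "4 / (odd_pi j ^ (2 * N) * (0\<^sup>2 + (odd_pi j)\<^sup>2)) \<le>
        4 / (odd_pi j ^ (2 * 0) * (0\<^sup>2 + (odd_pi j)\<^sup>2)) * (1 / pi ^ (2 * N))" for j
    using power_mono[OF odd_pi_ge_pi[of j], of "2 * N"]
    by (simp add: divide_simps mult_right_mono)
  hence "tanh_tail N 0 \<le> (\<Sum>j. 4 / (odd_pi j ^ (2 * 0) * (0\<^sup>2 + (odd_pi j)\<^sup>2)) * (1 / pi ^ (2 * N)))"
    unfolding tanh_tail_def by (intro suminf_le summable_tanh_tail summable_mult2)
  also have "\<dots> = tanh_tail 0 0 / pi ^ (2 * N)"
    unfolding tanh_tail_def by (subst suminf_mult2[symmetric]) (use summable_tanh_tail[of 0 0] in auto)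
  finally show ?thesis .
qed

text \<open>The exact remainder is at most a constant times \<open>(t / pi) ^ (2 * N)\<close>,
  because every pole has modulus at least \<open>pi\<close>.\<close>

lemma tanh_sums:
  assumes "\<bar>t\<bar> < pi"
  shows "(\<lambda>k. (-1) ^ k * tanh_tail k 0 * t ^ (2 * k + 1)) sums tanh (t / 2)"
proof -
  have "(\<lambda>N. (-1) ^ N * t ^ (2 * N + 1) * tanh_tail N t) \<longlonglongrightarrow> 0"
  proof (rule Lim_null_comparison)
    show "(\<lambda>N. \<bar>t\<bar> * tanh_tail 0 0 * ((t / pi)\<^sup>2) ^ N) \<longlonglongrightarrow> 0"
      using assms by (intro tendsto_mult_right_zero LIMSEQ_realpow_zero)
        (auto simp: power_divide divide_less_eq abs_square_less_1 simp flip: abs_le_square_iff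
              intro!: power2_strict_mono)
    show "\<forall>\<^sub>F N in sequentially. norm ((-1) ^ N * t ^ (2 * N + 1) * tanh_tail N t)
            \<le> \<bar>t\<bar> * tanh_tail 0 0 * ((t / pi)\<^sup>2) ^ N"
    proof (intro always_eventually allI)
      fix N
      have "norm ((-1) ^ N * t ^ (2 * N + 1) * tanh_tail N t) = \<bar>t\<bar> ^ (2 * N + 1) * tanh_tail N t"
        using tanh_tail_pos[of N t] by (simp add: abs_mult power_abs)
      also have "\<dots> \<le> \<bar>t\<bar> ^ (2 * N + 1) * (tanh_tail 0 0 / pi ^ (2 * N))"
        using tanh_tail_le[of N t] tanh_tail_0_le[of N] by (intro mult_left_mono) auto
      also have "\<dots> = \<bar>t\<bar> * tanh_tail 0 0 * ((t / pi)\<^sup>2) ^ N"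
        by (simp add: power_mult power_divide)
      finally show "norm ((-1) ^ N * t ^ (2 * N + 1) * tanh_tail N t)
            \<le> \<bar>t\<bar> * tanh_tail 0 0 * ((t / pi)\<^sup>2) ^ N" .
    qed
  qed
  hence "(\<lambda>N. tanh (t / 2) - (-1) ^ N * t ^ (2 * N + 1) * tanh_tail N t) \<longlonglongrightarrow> tanh (t / 2) - 0"
    by (intro tendsto_diff tendsto_const)
  moreover have "(\<Sum>k<N. (-1) ^ k * tanh_tail k 0 * t ^ (2 * k + 1)) =
      tanh (t / 2) - (-1) ^ N * t ^ (2 * N + 1) * tanh_tail N t" for N
    using tanh_expansion[of t N] by linarith
  ultimately show ?thesis
    by (simp add: sums_def)
qed

text \<open>Coefficients are compared in \<open>2 / (exp t + 1) = 1 - tanh (t / 2)\<close>. The tanh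
  series is known for real \<open>t\<close> only, so the power series of the difference is shown to
  vanish on a real interval, and isolation of zeros does the rest.\<close>

lemma euler_poly_odd_at_0:
  "euler_poly (2 * k + 1) 0 / fact (2 * k + 1) = - of_real ((-1) ^ k * tanh_tail k 0)"
proof -
  \<comment> \<open>\<open>c\<close> lists the Taylor coefficients of \<open>tanh (t / 2)\<close>,
    and \<open>e\<close> those of \<open>2 / (exp t + 1) - 1 + tanh (t / 2)\<close>; the constant
    \<open>-1\<close> sits at index 0, where \<open>c\<close> is zero.\<close>
  define c where "c n = (if even n then 0 else (-1) ^ (n div 2) * tanh_tail (n div 2) 0)" for n
  define e where "e n = euler_poly n 0 / fact n + (if n = 0 then -1 else complex_of_real (c n))" for n
  have c_sums: "(\<lambda>n. c n * t ^ n) sums tanh (t / 2)" if "\<bar>t\<bar> < pi" for t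
  proof -
    have "(\<lambda>k. c (2 * k + 1) * t ^ (2 * k + 1)) sums tanh (t / 2)"
      using tanh_sums[OF that] by (simp add: c_def)
    also have "?this \<longleftrightarrow> ?thesis"
      by (rule sums_mono_reindex[of "\<lambda>k. 2 * k + 1"])
         (auto simp: strict_mono_def c_def elim!: oddE)
    finally show ?thesis .
  qed
  \<comment> \<open>Convergence at a real radius \<open>r\<close> strictly between
    \<open>norm z\<close> and \<open>pi\<close> carries over to the complex point
    \<open>z\<close>.\<close>
  have c_abs: "summable (\<lambda>n. complex_of_real (c n) * z ^ n)" if z: "norm z < pi" for z
  proof -
    obtain r where r: "norm z < r" "r < pi"
      using dense[OF z] by blast
    have "(\<lambda>n. c n * r ^ n) sums tanh (r / 2)"
      using r norm_ge_zero[of z] by (intro c_sums) linarith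
    hence "summable (\<lambda>n. complex_of_real (c n * r ^ n))"
      by (intro summable_of_real) (simp add: sums_iff)
    hence "summable (\<lambda>n. complex_of_real (c n) * of_real r ^ n)"
      by simp
    thus ?thesis
      by (rule powser_inside) (use r in auto)
  qed
  define f where "f z = (\<Sum>n. e n * z ^ n)" for z
  have e_sums: "(\<lambda>n. e n * z ^ n) sums (2 / (exp z + 1) - 1 + (\<Sum>n. complex_of_real (c n) * z ^ n))"
    if "norm z < pi" for z
  proof -
    have "(\<lambda>n. euler_poly n 0 * z ^ n / fact n + ((if n = 0 then -1 else 0) + complex_of_real (c n) * z ^ n)) sums
            (2 * exp (0 * z) / (exp z + 1) + (-1 + (\<Sum>n. complex_of_real (c n) * z ^ n)))"
      by (intro sums_add euler_poly_sums that summable_sums c_abs sums_single[of 0 "\<lambda>_. -1"])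
    also have "(\<lambda>n. euler_poly n 0 * z ^ n / fact n + ((if n = 0 then -1 else 0) + complex_of_real (c n) * z ^ n)) =
               (\<lambda>n. e n * z ^ n)"
      by (auto simp: e_def c_def fun_eq_iff algebra_simps)
    finally show ?thesis
      by (simp add: algebra_simps)
  qed
  hence e_sums': "(\<lambda>n. e n * (z - 0) ^ n) sums f z" if "norm (z - 0) < pi" for z
    using that by (simp add: f_def sums_iff)
  have f_real: "f (of_real t) = 0" if "\<bar>t\<bar> < pi" for t
  proof -
    have "(\<lambda>n. complex_of_real (c n * t ^ n)) sums of_real (tanh (t / 2))"
      using c_sums[OF that] by (simp only: sums_of_real_iff)
    hence "(\<Sum>n. complex_of_real (c n) * of_real t ^ n) = of_real (tanh (t / 2))"
      by (simp add: sums_iff)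
    with e_sums[of "of_real t"] that
    have "f (of_real t) = 2 / (exp (of_real t) + 1) - 1 + complex_of_real (tanh (t / 2))"
      by (simp add: f_def sums_iff)
    also have "\<dots> = complex_of_real (2 / (exp t + 1) - 1 + tanh (t / 2))"
      by (simp add: exp_of_real)
    also have "tanh (t / 2) = 1 - 2 / (exp t + 1)"
    proof -
      have "1 + inverse (exp t) \<noteq> 0" "exp t + 1 \<noteq> 0"
        using add_pos_pos[OF zero_less_one, of "inverse (exp t)"] add_pos_pos[OF exp_gt_zero[of t] zero_less_one] by auto
      thus ?thesis
        by (simp add: tanh_real_altdef exp_minus divide_simps)
    qed
    finally show ?thesis by simp
  qed
  have "e (2 * k + 1) = 0"
  proof (rule ccontr)
    assume "e (2 * k + 1) \<noteq> 0"
    \<comment> \<open>A power series with a nonzero coefficient has no zero in some punctured disc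
      around the centre; the real point \<open>min r 1\<close> contradicts this.\<close>
    then obtain r where r: "r > 0" "\<And>z. z \<in> cball 0 r - {0} \<Longrightarrow> f z \<noteq> 0"
      using powser_0_nonzero[OF pi_gt_zero e_sums', of "2 * k + 1"] f_real[of 0] by auto
    have "f (of_real (min r 1)) = 0"
      using r(1) pi_gt3 by (intro f_real) auto
    moreover have "complex_of_real (min r 1) \<in> cball 0 r - {0}"
      using r(1) by auto
    ultimately show False
      using r(2) by blast
  qed
  thus ?thesis
    by (simp add: e_def c_def eq_neg_iff_add_eq_0)
qed

section \<open>Holomorphic parametric integrals\<close>

text \<open>Local domination of \<open>f\<close> itself suffices: the Cauchy inequality turns it
  into a bound on the complex derivative, hence on difference quotients, and dominated convergence
  gives the derivative of the integral.\<close>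

lemma holomorphic_on_integral_param:
  fixes f :: "complex \<Rightarrow> 'a \<Rightarrow> complex"
  assumes "open S"
  assumes hol: "\<And>t. t \<in> space M \<Longrightarrow> (\<lambda>z. f z t) holomorphic_on S"
  assumes meas: "\<And>z. z \<in> S \<Longrightarrow> f z \<in> borel_measurable M"
  assumes dom: "\<And>z0. z0 \<in> S \<Longrightarrow> \<exists>r>0. \<exists>g. integrable M g \<and>
                  (\<forall>z\<in>ball z0 r \<inter> S. \<forall>t\<in>space M. norm (f z t) \<le> g t)"
  shows "(\<lambda>z. integral\<^sup>L M (f z)) holomorphic_on S"
proof (unfold holomorphic_on_def, intro ballI)
  fix z0 assume z0: "z0 \<in> S"
  obtain r0 g where r0: "r0 > 0" and g: "integrable M g"
    and bound0: "\<And>z t. z \<in> ball z0 r0 \<Longrightarrow> z \<in> S \<Longrightarrow> t \<in> space M \<Longrightarrow> norm (f z t) \<le> g t"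
    using dom[OF z0] by blast
  obtain r1 where r1: "r1 > 0" "ball z0 r1 \<subseteq> S"
    using \<open>open S\<close> z0 by (meson open_contains_ball)
  \<comment> \<open>With a third of the radius, closed discs of radius \<open>r\<close> about points
    of \<open>ball z0 r\<close> stay where \<open>g\<close> dominates.\<close>
  define r where "r = min r0 r1 / 3"
  have r: "r > 0" using r0 r1 by (simp add: r_def)
  have bound: "norm (f z t) \<le> g t" "z \<in> S" if "z \<in> ball z0 (3 * r)" "t \<in> space M" for z t
    using that r1 by (auto simp: r_def intro!: bound0)
  have ball_S: "ball z0 (3 * r) \<subseteq> S"
    using r1 by (auto simp: r_def)
  have f_int: "integrable M (f z)" if "z \<in> ball z0 (3 * r)" for z
    by (rule Bochner_Integration.integrable_bound[OF g meas])
       (use that bound ball_S in \<open>auto intro!: AE_I2 intro: order_trans[OF _ abs_ge_self]\<close>)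
  have deriv_bound: "norm (deriv (\<lambda>z. f z t) z) \<le> g t / r" if z: "z \<in> ball z0 r" and t: "t \<in> space M" for z t
  proof -
    have sub: "cball z r \<subseteq> ball z0 (3 * r)"
      using z r by (intro subsetI) (simp add: dist_commute, smt (verit) dist_triangle dist_commute)
    have "norm ((deriv ^^ 1) (\<lambda>z. f z t) z) \<le> fact 1 * g t / r ^ 1"
    proof (rule Cauchy_inequality)
      show "(\<lambda>z. f z t) holomorphic_on ball z r"
        by (intro holomorphic_on_subset[OF hol[OF t]] order_trans[OF order_trans[OF ball_subset_cball sub] ball_S])
      show "continuous_on (cball z r) (\<lambda>z. f z t)"
        by (intro holomorphic_on_imp_continuous_on holomorphic_on_subset[OF hol[OF t]] order_trans[OF sub ball_S])
      show "norm (f w t) \<le> g t" if "norm (z - w) = r" for w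
        using that sub t by (intro bound) (auto simp: dist_norm subset_iff)
    qed (use r in auto)
    thus ?thesis by simp
  qed
  have Lipschitz: "norm (f z t - f z0 t) \<le> g t / r * norm (z - z0)" if "z \<in> ball z0 r" "t \<in> space M" for z t
  proof (rule field_differentiable_bound[of "ball z0 r"])
    fix w assume w: "w \<in> ball z0 r"
    have "(\<lambda>z. f z t) field_differentiable at w"
      using w that r ball_S \<open>open S\<close> by (intro holomorphic_on_imp_differentiable_at[OF hol]) auto
    thus "((\<lambda>z. f z t) has_field_derivative deriv (\<lambda>z. f z t) w) (at w within ball z0 r)"
      by (simp add: DERIV_deriv_iff_field_differentiable has_field_derivative_at_within)
  qed (use that r deriv_bound in auto)
  define Q where "Q z t = (f z t - f z0 t) / (z - z0)" for z t
  have lim: "((\<lambda>z. Q z t) \<longlongrightarrow> deriv (\<lambda>z. f z t) z0) (at z0)" if "t \<in> space M" for t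
  proof -
    have "(\<lambda>z. f z t) field_differentiable at z0"
      using that z0 \<open>open S\<close> by (intro holomorphic_on_imp_differentiable_at[OF hol]) auto
    thus ?thesis
      unfolding Q_def by (simp add: DERIV_deriv_iff_field_differentiable[symmetric] has_field_derivative_iff)
  qed
  \<comment> \<open>The limit is tested along sequences, the setting of dominated
    convergence.\<close>
  have "((\<lambda>z. integral\<^sup>L M (Q z)) \<longlongrightarrow> (\<integral>t. deriv (\<lambda>z. f z t) z0 \<partial>M)) (at z0 within ball z0 r)"
    unfolding tendsto_at_iff_sequentially comp_def
  proof safe
    fix X assume X: "\<forall>i. X i \<in> ball z0 r - {z0}" "X \<longlonglongrightarrow> z0"
    have X': "X i \<in> ball z0 (3 * r)" for i
      using X(1)[rule_format, of i] r by auto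
    have XQ [measurable]: "Q (X i) \<in> borel_measurable M" for i
    proof -
      have [measurable]: "f (X i) \<in> borel_measurable M" "f z0 \<in> borel_measurable M"
        using X'[of i] ball_S z0 by (auto intro!: meas)
      show ?thesis unfolding Q_def by measurable
    qed
    have XL: "(\<lambda>i. Q (X i) t) \<longlonglongrightarrow> deriv (\<lambda>z. f z t) z0" if "t \<in> space M" for t
      using lim[OF that] X unfolding tendsto_at_iff_sequentially comp_def by auto
    show "(\<lambda>i. integral\<^sup>L M (Q (X i))) \<longlonglongrightarrow> (\<integral>t. deriv (\<lambda>z. f z t) z0 \<partial>M)"
    proof (rule integral_dominated_convergence[where w = "\<lambda>t. g t / r"])
      \<comment> \<open>The derivative is measurable in \<open>t\<close> as a pointwise limit of
        measurable difference quotients.\<close>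
      show "(\<lambda>t. deriv (\<lambda>z. f z t) z0) \<in> borel_measurable M"
        by (rule borel_measurable_LIMSEQ_metric[OF XQ XL])
      show "AE t in M. (\<lambda>i. Q (X i) t) \<longlonglongrightarrow> deriv (\<lambda>z. f z t) z0"
        by (intro AE_I2 XL)
      show "AE t in M. norm (Q (X i) t) \<le> g t / r" for i
      proof (rule AE_I2)
        fix t assume t: "t \<in> space M"
        have "X i \<in> ball z0 r" "X i - z0 \<noteq> 0"
          using X(1)[rule_format, of i] by auto
        thus "norm (Q (X i) t) \<le> g t / r"
          using Lipschitz[of "X i" t] t unfolding Q_def by (simp add: norm_divide divide_le_eq)
      qed
    qed (use g in auto)
  qed
  hence "((\<lambda>z. integral\<^sup>L M (Q z)) \<longlongrightarrow> (\<integral>t. deriv (\<lambda>z. f z t) z0 \<partial>M)) (at z0)"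
    using r by (subst (asm) at_within_open) auto
  moreover have "eventually (\<lambda>z. z \<in> ball z0 r) (at z0)"
    unfolding eventually_at using r by (auto simp: dist_commute intro!: exI[of _ r])
  hence "eventually (\<lambda>z. integral\<^sup>L M (Q z) = (integral\<^sup>L M (f z) - integral\<^sup>L M (f z0)) / (z - z0)) (at z0)"
  proof eventually_elim
    case (elim z)
    have "integrable M (f z)" "integrable M (f z0)"
      using elim r by (auto intro!: f_int)
    thus ?case by (simp add: Q_def[abs_def])
  qed
  ultimately have "((\<lambda>z. (integral\<^sup>L M (f z) - integral\<^sup>L M (f z0)) / (z - z0)) \<longlongrightarrow>
      (\<integral>t. deriv (\<lambda>z. f z t) z0 \<partial>M)) (at z0)"
    using tendsto_cong[of "\<lambda>z. integral\<^sup>L M (Q z)"] by simp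
  hence "((\<lambda>z. integral\<^sup>L M (f z)) has_field_derivative (\<integral>t. deriv (\<lambda>z. f z t) z0 \<partial>M)) (at z0)"
    by (simp add: has_field_derivative_iff)
  thus "(\<lambda>z. integral\<^sup>L M (f z)) field_differentiable at z0 within S"
    using field_differentiable_at_within field_differentiable_def by blast
qed

section \<open>Gamma integrals with a complex rate\<close>

text \<open>
  The kernel \<open>t\<^bsup>p-1\<^esup> e\<^bsup>-zt\<^esup>\<close> on \<open>t > 0\<close>, written with \<open>exp\<close> and \<open>ln\<close> so that measurability in \<open>t\<close> and
  holomorphy in \<open>p\<close> and \<open>z\<close> are immediate.
\<close>

definition gamma_kernel :: "complex \<Rightarrow> complex \<Rightarrow> real \<Rightarrow> complex" where
  "gamma_kernel p z t = (if t > 0 then exp ((p - 1) * of_real (ln t) - z * of_real t) else 0)"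

text \<open>The modulus of \<open>gamma_kernel\<close>, used as the dominating function and, when
  normalised, as the Gamma density.\<close>

definition gamma_kernel_real :: "real \<Rightarrow> real \<Rightarrow> real \<Rightarrow> real" where
  "gamma_kernel_real a b t = (if t > 0 then exp ((a - 1) * ln t - b * t) else 0)"

lemma gamma_kernel_measurable [measurable]: "gamma_kernel p z \<in> borel_measurable borel"
  unfolding gamma_kernel_def by measurable

lemma gamma_kernel_real_measurable [measurable]: "gamma_kernel_real a b \<in> borel_measurable borel"
  unfolding gamma_kernel_real_def by measurable

lemma gamma_kernel_of_real: "gamma_kernel (of_real a) (of_real b) t = of_real (gamma_kernel_real a b t)"
  by (simp add: gamma_kernel_def gamma_kernel_real_def flip: exp_of_real)

lemma norm_gamma_kernel: "norm (gamma_kernel p z t) = gamma_kernel_real (Re p) (Re z) t"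
  by (simp add: gamma_kernel_def gamma_kernel_real_def)

lemma gamma_kernel_real_nonneg: "gamma_kernel_real a b t \<ge> 0"
  by (simp add: gamma_kernel_real_def)

lemma gamma_kernel_powr:
  "gamma_kernel p z t = indicator {0<..} t *\<^sub>R (of_real t powr (p - 1) * exp (- (z * of_real t)))"
  by (simp add: gamma_kernel_def powr_def Ln_of_real flip: exp_add)

lemma integrable_gamma_kernel_of_real:
  assumes "Re p > 0" "b > 0"
  shows "integrable lborel (gamma_kernel p (of_real b))"
proof -
  have "integrable lebesgue (\<lambda>t. indicator {0<..} t *\<^sub>R (complex_of_real t powr (p - 1) / of_real (exp (b * t))))"
    using absolutely_integrable_Gamma_integral[OF assms] by (simp add: set_integrable_def)
  also have "(\<lambda>t. indicator {0<..} t *\<^sub>R (complex_of_real t powr (p - 1) / of_real (exp (b * t)))) =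
             gamma_kernel p (of_real b)"
    by (simp add: gamma_kernel_powr fun_eq_iff exp_minus field_simps flip: exp_of_real)
  finally show ?thesis
    by (subst (asm) integrable_completion) auto
qed

lemma integrable_gamma_kernel_real:
  assumes "a > 0" "b > 0"
  shows "integrable lborel (gamma_kernel_real a b)"
  using integrable_norm[OF integrable_gamma_kernel_of_real[of "of_real a" b]] assms
  by (simp add: norm_gamma_kernel)

lemma integrable_gamma_kernel:
  assumes "Re p > 0" "Re z > 0"
  shows "integrable lborel (gamma_kernel p z)"
  by (rule Bochner_Integration.integrable_bound[OF integrable_gamma_kernel_real[OF assms]])
     (auto simp: norm_gamma_kernel gamma_kernel_real_nonneg)

lemma integral_gamma_kernel_1:
  assumes "Re p > 0"
  shows "(\<integral>t. gamma_kernel p 1 t \<partial>lborel) = Gamma p"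
proof -
  have *: "(\<lambda>t. indicator {0<..} t *\<^sub>R (complex_of_real t powr (p - 1) / of_real (exp t))) = gamma_kernel p 1"
    by (simp add: gamma_kernel_powr fun_eq_iff exp_minus field_simps flip: exp_of_real)
  have "set_integrable lborel {0<..} (\<lambda>t. complex_of_real t powr (p - 1) / of_real (exp t))"
    unfolding set_integrable_def * using integrable_gamma_kernel[of p 1] assms by simp
  from set_borel_integral_eq_integral(2)[OF this] Gamma_integral_complex'[OF assms]
  show ?thesis
    by (simp add: set_lebesgue_integral_def * has_integral_iff)
qed

text \<open>The substitution \<open>t\<close> to \<open>b * t\<close> reduces a real rate to rate 1;
  complex rates follow by analytic continuation.\<close>

lemma integral_gamma_kernel_of_real:
  assumes "Re p > 0" "b > 0"
  shows "(\<integral>t. gamma_kernel p (of_real b) t \<partial>lborel) = Gamma p * of_real b powr (-p)"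
proof -
  have "gamma_kernel p 1 (b * t) = exp ((p - 1) * of_real (ln b)) * gamma_kernel p (of_real b) t" for t
    using assms by (auto simp: gamma_kernel_def ln_mult zero_less_mult_iff ring_distribs exp_add[symmetric] algebra_simps)
  hence "Gamma p = of_real b * (exp ((p - 1) * of_real (ln b)) * (\<integral>t. gamma_kernel p (of_real b) t \<partial>lborel))"
    using lborel_integral_real_affine[of b "gamma_kernel p 1" 0] assms
    by (simp add: integral_gamma_kernel_1 scaleR_conv_of_real)
  moreover have "of_real b * exp ((p - 1) * of_real (ln b)) = exp (p * complex_of_real (ln b))"
    using assms by (simp add: ring_distribs exp_diff exp_of_real)
  ultimately have "Gamma p = exp (p * of_real (ln b)) * (\<integral>t. gamma_kernel p (of_real b) t \<partial>lborel)"
    by (simp only: mult.assoc[symmetric])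
  thus ?thesis
    using assms by (simp add: powr_def Ln_of_real exp_minus field_simps)
qed

lemma integral_gamma_kernel_real:
  assumes "a > 0" "b > 0"
  shows "(\<integral>t. gamma_kernel_real a b t \<partial>lborel) = Gamma a * b powr (-a)"
proof -
  have "complex_of_real (\<integral>t. gamma_kernel_real a b t \<partial>lborel) =
        (\<integral>t. gamma_kernel (of_real a) (of_real b) t \<partial>lborel)"
    by (simp only: gamma_kernel_of_real integral_complex_of_real)
  also have "\<dots> = Gamma (of_real a) * of_real b powr (- of_real a)"
    using assms by (intro integral_gamma_kernel_of_real) auto
  also have "\<dots> = of_real (Gamma a * b powr (-a))"
    using assms by (simp only: Gamma_complex_of_real of_real_mult of_real_minus[symmetric] powr_of_real less_imp_le)
  finally show ?thesis
    by (simp only: of_real_eq_iff)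
qed

section \<open>Identity theorem on half-planes and holomorphy in the parameters\<close>

lemma holomorphic_halfplane_eqI:
  assumes "f holomorphic_on {z. Re z > a}" "g holomorphic_on {z. Re z > a}"
    and "\<And>x. x > b \<Longrightarrow> f (of_real x) = g (of_real x)" and "Re z > a"
  shows "f z = g z"
proof -
  \<comment> \<open>The reals beyond \<open>max a b\<close> accumulate at \<open>x0\<close>, an
    interior point of the half-plane, as the identity theorem requires.\<close>
  define x0 where "x0 = max a b + 1"
  define U where "U = complex_of_real ` {max a b<..}"
  have "x0 islimpt {max a b<..}"
    by (rule interior_limit_point) (simp add: x0_def interior_open)
  hence lim: "complex_of_real x0 islimpt U"
    unfolding U_def islimpt_approachable
    by (metis dist_of_real image_eqI of_real_eq_iff)
  have "f z - g z = 0"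
  proof (rule analytic_continuation[of "\<lambda>z. f z - g z" "{z. Re z > a}" U "of_real x0"])
    show "(\<lambda>z. f z - g z) holomorphic_on {z. Re z > a}"
      by (intro holomorphic_intros assms)
    show "connected {z. Re z > a}"
      by (intro convex_connected convex_halfspace_Re_gt)
  qed (use assms lim in \<open>auto simp: open_halfspace_Re_gt U_def x0_def\<close>)
  thus ?thesis by simp
qed

text \<open>Both sides are holomorphic in the rate \<open>z\<close> on the right half-plane and
  agree for positive real rates.\<close>

lemma integral_gamma_kernel:
  assumes p: "Re p > 0" and z: "Re z > 0"
  shows "(\<integral>t. gamma_kernel p z t \<partial>lborel) = Gamma p * z powr (-p)"
proof (rule holomorphic_halfplane_eqI[of "\<lambda>z. \<integral>t. gamma_kernel p z t \<partial>lborel" 0 "\<lambda>z. Gamma p * z powr (-p)" 0])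
  show "(\<lambda>z. \<integral>t. gamma_kernel p z t \<partial>lborel) holomorphic_on {z. Re z > 0}"
  proof (rule holomorphic_on_integral_param)
    show "open {z. Re z > 0}" by (rule open_halfspace_Re_gt)
    show "(\<lambda>z. gamma_kernel p z t) holomorphic_on {z. Re z > 0}" for t
      unfolding gamma_kernel_def by (cases "t > 0") (auto intro!: holomorphic_intros)
    show "gamma_kernel p z \<in> borel_measurable lborel" for z
      by simp
    fix z0 :: complex assume "z0 \<in> {z. Re z > 0}"
    hence z0: "Re z0 > 0" by simp
    have "norm (gamma_kernel p z t) \<le> gamma_kernel_real (Re p) (Re z0 / 2) t"
      if "z \<in> ball z0 (Re z0 / 2)" for z t
    proof -
      have "\<bar>Re (z0 - z)\<bar> < Re z0 / 2"
        using that abs_Re_le_cmod[of "z0 - z"] by (simp add: dist_norm)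
      hence "Re z \<ge> Re z0 / 2" by (simp add: abs_if split: if_splits)
      thus ?thesis
        by (auto simp: norm_gamma_kernel gamma_kernel_real_def mult_right_mono)
    qed
    moreover have "integrable lborel (gamma_kernel_real (Re p) (Re z0 / 2))"
      using z0 p by (intro integrable_gamma_kernel_real) auto
    ultimately show "\<exists>r>0. \<exists>g. integrable lborel g \<and>
        (\<forall>z\<in>ball z0 r \<inter> {z. Re z > 0}. \<forall>t\<in>space lborel. norm (gamma_kernel p z t) \<le> g t)"
      using z0 by (intro exI[of _ "Re z0 / 2"] conjI exI[of _ "gamma_kernel_real (Re p) (Re z0 / 2)"]) auto
  qed
  show "(\<lambda>z. Gamma p * z powr (-p)) holomorphic_on {z. Re z > 0}"
    by (intro holomorphic_intros) (auto elim!: nonpos_Reals_cases)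
qed (use assms integral_gamma_kernel_of_real in auto)

lemma holomorphic_weighted_gamma_kernel:
  fixes h :: "real \<Rightarrow> complex"
  assumes q: "q > 0" and [measurable]: "h \<in> borel_measurable borel" and bound: "\<And>t. norm (h t) \<le> B"
  shows "(\<lambda>p. \<integral>t. gamma_kernel p (of_real q) t * h t \<partial>lborel) holomorphic_on {p. Re p > 0}"
proof (rule holomorphic_on_integral_param)
  show "open {z. Re z > 0}" by (rule open_halfspace_Re_gt)
  show "(\<lambda>p. gamma_kernel p (of_real q) t * h t) holomorphic_on {p. Re p > 0}" for t
    unfolding gamma_kernel_def by (cases "t > 0") (auto intro!: holomorphic_intros)
  show "(\<lambda>t. gamma_kernel p (of_real q) t * h t) \<in> borel_measurable lborel" for p
    by simp
  fix p0 :: complex assume "p0 \<in> {p. Re p > 0}"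
  hence p0: "Re p0 > 0" by simp
  \<comment> \<open>For \<open>t\<close> at least 1 the power of \<open>t\<close> is largest at the
    upper exponent, for smaller positive \<open>t\<close> at the lower one; the sum of both kernels
    dominates throughout.\<close>
  define g where "g t = (gamma_kernel_real (Re p0 / 2) q t + gamma_kernel_real (2 * Re p0) q t) * B" for t
  have "norm (gamma_kernel p (of_real q) t * h t) \<le> g t"
    if "p \<in> ball p0 (Re p0 / 2)" for p t
  proof -
    have "\<bar>Re (p0 - p)\<bar> < Re p0 / 2"
      using that abs_Re_le_cmod[of "p0 - p"] by (simp add: dist_norm)
    hence p: "Re p \<ge> Re p0 / 2" "Re p \<le> 2 * Re p0" 
      by (simp_all add: abs_if split: if_splits)
    have "gamma_kernel_real (Re p) q t \<le> gamma_kernel_real (Re p0 / 2) q t + gamma_kernel_real (2 * Re p0) q t"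
    proof (cases "ln t \<ge> 0")
      case True
      hence "(Re p - 1) * ln t \<le> (2 * Re p0 - 1) * ln t"
        using p by (intro mult_right_mono) auto
      hence "gamma_kernel_real (Re p) q t \<le> gamma_kernel_real (2 * Re p0) q t"
        by (simp add: gamma_kernel_real_def)
      thus ?thesis using gamma_kernel_real_nonneg[of "Re p0 / 2" q t] by linarith
    next
      case False
      hence "(Re p - 1) * ln t \<le> (Re p0 / 2 - 1) * ln t"
        using p by (intro mult_right_mono_neg) auto
      hence "gamma_kernel_real (Re p) q t \<le> gamma_kernel_real (Re p0 / 2) q t"
        by (simp add: gamma_kernel_real_def)
      thus ?thesis using gamma_kernel_real_nonneg[of "2 * Re p0" q t] by linarith
    qed
    thus ?thesis
      unfolding norm_mult g_def norm_gamma_kernel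
      by (intro mult_mono bound) (auto simp: gamma_kernel_real_nonneg)
  qed
  moreover have "integrable lborel g"
    unfolding g_def using p0 q
    by (intro integrable_mult_left Bochner_Integration.integrable_add integrable_gamma_kernel_real) auto
  ultimately show "\<exists>r>0. \<exists>g. integrable lborel g \<and>
      (\<forall>p\<in>ball p0 r \<inter> {p. Re p > 0}. \<forall>t\<in>space lborel. norm (gamma_kernel p (of_real q) t * h t) \<le> g t)"
    using p0 by (intro exI[of _ "Re p0 / 2"] conjI exI[of _ g]) auto
qed

section \<open>The function Pi as a Laplace-type integral\<close>

lemma gamma_kernel_shift_arg:
  "gamma_kernel p z t * exp (- (v * of_real t)) = gamma_kernel p (z + v) t"
  by (simp add: gamma_kernel_def algebra_simps flip: exp_add)

lemma Gamma_complex_nonzero_right_halfplane: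
  assumes "Re z > 0"
  shows "Gamma z \<noteq> 0"
proof -
  have "z \<notin> \<int>\<^sub>\<le>\<^sub>0"
    using assms by (auto elim!: nonpos_Ints_cases)
  thus ?thesis
    by (simp add: Gamma_eq_zero_iff)
qed

text \<open>The complex power is written as a Gamma integral with rate
  \<open>q + \<i> * c * u\<close>. After exchanging the integrals, the inner one over
  \<open>u\<close> is exponential with value \<open>1 / (1 + \<i> * c * t)\<close>.\<close>

lemma gamma_kernel_Fubini:
  assumes p: "Re p > 0" and q: "q > 0"
  shows "(\<integral>u. gamma_kernel 1 1 u * (of_real q + \<i> * of_real (c * u)) powr (-p) \<partial>lborel) =
         rGamma p * (\<integral>t. gamma_kernel p (of_real q) t * (1 / (1 + \<i> * of_real (c * t))) \<partial>lborel)"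
proof -
  \<comment> \<open>The last factor has modulus 1, so the norm of \<open>F\<close> is a product of
    two integrable real kernels.\<close>
  define F where "F u t = gamma_kernel 1 1 u * gamma_kernel p (of_real q) t * exp (- (\<i> * of_real (c * u) * of_real t))"
    for u t :: real
  have norm_F: "norm (F u t) = gamma_kernel_real 1 1 u * gamma_kernel_real (Re p) q t" for u t
    by (simp add: F_def norm_mult norm_gamma_kernel)
  have F_t: "F u t = gamma_kernel 1 1 u * gamma_kernel p (of_real q + \<i> * of_real (c * u)) t" for u t
    unfolding F_def gamma_kernel_shift_arg[symmetric] by (simp add: mult_ac)
  have F_u: "F u t = gamma_kernel p (of_real q) t * gamma_kernel 1 (1 + \<i> * of_real (c * t)) u" for u t
    unfolding F_def gamma_kernel_shift_arg[symmetric] by (simp add: mult_ac)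
  have "integrable (lborel \<Otimes>\<^sub>M lborel) (case_prod F)"
  proof (rule lborel_pair.Fubini_integrable)
    show "case_prod F \<in> borel_measurable (lborel \<Otimes>\<^sub>M lborel)"
      unfolding F_def by measurable
    show "integrable lborel (\<lambda>u. \<integral>t. norm (case_prod F (u, t)) \<partial>lborel)"
      using p q by (simp add: norm_F integrable_gamma_kernel_real)
    show "AE u in lborel. integrable lborel (\<lambda>t. case_prod F (u, t))"
      using p q by (simp add: F_t integrable_gamma_kernel)
  qed
  hence "(\<integral>t. (\<integral>u. F u t \<partial>lborel) \<partial>lborel) = (\<integral>u. (\<integral>t. F u t \<partial>lborel) \<partial>lborel)"
    by (rule lborel_pair.Fubini_integral)
  moreover have "(\<integral>u. F u t \<partial>lborel) = gamma_kernel p (of_real q) t * (1 / (1 + \<i> * of_real (c * t)))" for t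
  proof -
    have "1 + \<i> * complex_of_real (c * t) \<noteq> 0"
      by (simp add: complex_eq_iff)
    thus ?thesis
      by (simp add: F_u integral_gamma_kernel powr_minus field_simps)
  qed
  moreover have "rGamma p * (\<integral>t. F u t \<partial>lborel) =
      gamma_kernel 1 1 u * (of_real q + \<i> * of_real (c * u)) powr (-p)" for u
  proof -
    have "rGamma p * Gamma p = 1"
      using Gamma_complex_nonzero_right_halfplane[OF p] by (simp add: rGamma_inverse_Gamma)
    thus ?thesis
      using p q by (simp add: F_t integral_gamma_kernel)
  qed
  ultimately show ?thesis
    by (simp flip: integral_mult_right_zero)
qed

text \<open>With \<open>w = a * q\<close>, a point of the integration ray is \<open>\<sigma> * \<i>
  * w + u = \<sigma> * \<i> * a * (q - \<sigma> * \<i> * u / a)\<close>. Its power \<open>-p\<close>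
  cancels the phase in front and the factor \<open>a powr p\<close>; the sign
  \<open>\<sigma>\<close> covers both halves of \<open>Pi_term\<close>.\<close>

lemma upper_inc_Gamma_rotated:
  assumes a: "a > 0" and q: "q > 0" and \<sigma>: "\<sigma> = 1 \<or> \<sigma> = (-1 :: real)"
  shows "of_real (a * q) powr p *
           (exp (\<sigma> * (of_real pi / 2 * \<i> * p)) * exp (\<sigma> * (\<i> * of_real (a * q))) *
             upper_inc_Gamma (1 - p) (of_real (a * q) * exp (\<sigma> * (of_real pi / 2 * \<i>)))) =
         of_real q powr p *
           (\<integral>u. gamma_kernel 1 1 u * (of_real q + \<i> * of_real (- \<sigma> / a * u)) powr (-p) \<partial>lborel)"
proof -
  define w where "w = a * q"
  have w: "w > 0" using a q by (simp add: w_def)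
  have rot: "exp (complex_of_real \<sigma> * (of_real pi / 2 * \<i>)) = of_real \<sigma> * \<i>"
  proof -
    have "exp (of_real pi / 2 * \<i>) = \<i>"
      using cis_conv_exp[of "pi / 2"] by (simp add: mult.commute)
    thus ?thesis
      using \<sigma> by (auto simp: exp_minus)
  qed
  \<comment> \<open>For \<open>Re x > 0\<close> a quarter turn stays off the branch cut. The case
    \<open>\<sigma> = -1\<close> reads the rule for multiplication by \<open>\<i>\<close>
    backwards.\<close>
  have Ln_rot: "Ln (of_real \<sigma> * \<i> * x) = Ln x + of_real \<sigma> * (of_real pi / 2 * \<i>)" if "Re x > 0" for x
    using \<sigma> 
  proof
    assume "\<sigma> = 1"
    moreover have "x \<noteq> 0" using that by auto
    ultimately show ?thesis using that by (simp add: Ln_times_ii)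
  next
    assume "\<sigma> = -1"
    moreover have "x \<noteq> 0" using that by auto
    moreover have "Ln (\<i> * (- \<i> * x)) = Ln (- \<i> * x) + \<i> * of_real pi / 2"
      using that \<open>x \<noteq> 0\<close> by (subst Ln_times_ii) auto
    moreover have "\<i> * (- \<i> * x) = x"
      by simp
    ultimately show ?thesis
      by (simp add: algebra_simps)
  qed
  have point: "of_real w powr p * (exp (\<sigma> * (of_real pi / 2 * \<i> * p)) * exp (\<sigma> * (\<i> * of_real w)) *
          ((of_real w * exp (\<sigma> * (of_real pi / 2 * \<i>)) + of_real u) powr (1 - p - 1) *
           exp (- (of_real w * exp (\<sigma> * (of_real pi / 2 * \<i>)) + of_real u)))) =
        of_real q powr p * (exp (- of_real u) * (of_real q + \<i> * of_real (- \<sigma> / a * u)) powr (-p))" for u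
  proof -
    define x where "x = of_real q + \<i> * of_real (- \<sigma> / a * u)"
    have x: "Re x > 0" using q by (simp add: x_def)
    hence "x \<noteq> 0" by auto
    have "of_real w * exp (\<sigma> * (of_real pi / 2 * \<i>)) + of_real u = of_real \<sigma> * \<i> * (of_real a * x)"
      using a \<sigma> unfolding rot w_def x_def by (auto simp: complex_eq_iff)
    moreover have "Ln (of_real \<sigma> * \<i> * (of_real a * x)) = of_real (ln a) + Ln x + of_real \<sigma> * (of_real pi / 2 * \<i>)"
      using a x \<open>x \<noteq> 0\<close> by (subst Ln_rot) (simp_all add: Ln_times_of_real Ln_of_real)
    ultimately have "(of_real w * exp (\<sigma> * (of_real pi / 2 * \<i>)) + of_real u) powr (1 - p - 1) =
        exp (- p * (of_real (ln a) + Ln x + of_real \<sigma> * (of_real pi / 2 * \<i>)))"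
      using a x \<sigma> \<open>x \<noteq> 0\<close> by (auto simp: powr_def)
    moreover have "exp (- (of_real w * exp (\<sigma> * (of_real pi / 2 * \<i>)) + of_real u)) =
        exp (- (\<sigma> * (\<i> * of_real w)) - of_real u)"
      unfolding rot by (intro arg_cong[of _ _ exp]) (simp add: algebra_simps)
    moreover have "of_real w powr p = exp (p * (of_real (ln a) + of_real (ln q)))"
      using a q by (simp add: w_def powr_def Ln_of_real ln_mult del: of_real_mult)
    moreover have "of_real q powr p = exp (p * of_real (ln q))"
      using q by (simp add: powr_def Ln_of_real)
    moreover have "x powr (-p) = exp (-p * Ln x)"
      using \<open>x \<noteq> 0\<close> by (simp add: powr_def)
    ultimately show ?thesis
      unfolding x_def[symmetric] by (simp add: algebra_simps flip: exp_add)
  qed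
  let ?I = "\<lambda>u. (of_real w * exp (\<sigma> * (of_real pi / 2 * \<i>)) + of_real u) powr (1 - p - 1) *
           exp (- (of_real w * exp (\<sigma> * (of_real pi / 2 * \<i>)) + of_real u))"
  have "of_real w powr p * (exp (\<sigma> * (of_real pi / 2 * \<i> * p)) * exp (\<sigma> * (\<i> * of_real w)) *
             upper_inc_Gamma (1 - p) (of_real w * exp (\<sigma> * (of_real pi / 2 * \<i>)))) =
        (\<integral>u. of_real w powr p * (exp (\<sigma> * (of_real pi / 2 * \<i> * p)) * exp (\<sigma> * (\<i> * of_real w)) *
             (indicator {0..} u *\<^sub>R ?I u)) \<partial>lborel)"
    unfolding upper_inc_Gamma_def set_lebesgue_integral_def by (simp only: integral_mult_right_zero)
  also have "\<dots> = (\<integral>u. of_real q powr p * (gamma_kernel 1 1 u * (of_real q + \<i> * of_real (- \<sigma> / a * u)) powr (-p)) \<partial>lborel)"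
  \<comment> \<open>The integrands can differ only at \<open>u = 0\<close>, where the indicator is 1
    but \<open>gamma_kernel\<close> is 0 by definition.\<close>
  proof (rule integral_discrete_difference[of "{0}"])
    fix u :: real assume "u \<notin> {0}"
    thus "of_real w powr p * (exp (\<sigma> * (of_real pi / 2 * \<i> * p)) * exp (\<sigma> * (\<i> * of_real w)) *
             (indicator {0..} u *\<^sub>R ?I u)) =
          of_real q powr p * (gamma_kernel 1 1 u * (of_real q + \<i> * of_real (- \<sigma> / a * u)) powr (-p))"
      using point[of u] by (auto simp: gamma_kernel_def indicator_def)
  qed auto
  also have "\<dots> = of_real q powr p *
      (\<integral>u. gamma_kernel 1 1 u * (of_real q + \<i> * of_real (- \<sigma> / a * u)) powr (-p) \<partial>lborel)"
    by simp
  finally show ?thesis unfolding w_def .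
qed

text \<open>The two rotated incomplete Gamma functions contribute
  \<open>1 / (1 - \<i> * t / a)\<close> and \<open>1 / (1 + \<i> * t / a)\<close>, whose mean is
  \<open>a^2 / (t^2 + a^2)\<close>.\<close>

lemma Pi_term_Laplace:
  assumes p: "Re p > 0" and a: "a > 0" and q: "q > 0"
  shows "Pi_term p (of_real (a * q)) = of_real q powr p * rGamma p *
           (\<integral>t. gamma_kernel p (of_real q) t * of_real (a\<^sup>2 / (t\<^sup>2 + a\<^sup>2)) \<partial>lborel)"
proof -
  define I where "I \<sigma> = (\<integral>t. gamma_kernel p (of_real q) t * (1 / (1 + \<i> * of_real (- \<sigma> / a * t))) \<partial>lborel)"
    for \<sigma> :: real
  have nz: "1 + \<i> * complex_of_real x \<noteq> 0" for x
    by (simp add: complex_eq_iff)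
  have int: "integrable lborel (\<lambda>t. gamma_kernel p (of_real q) t * (1 / (1 + \<i> * of_real (c * t))))" for c
  proof (rule Bochner_Integration.integrable_bound[OF integrable_gamma_kernel[of p "of_real q"]])
    have "norm (1 / (1 + \<i> * of_real (c * t))) \<le> 1" for t
      using abs_Re_le_cmod[of "1 + \<i> * of_real (c * t)"] by (simp add: norm_divide divide_le_eq)
    thus "AE t in lborel. norm (gamma_kernel p (of_real q) t * (1 / (1 + \<i> * of_real (c * t)))) \<le>
        norm (gamma_kernel p (of_real q) t)"
      by (intro AE_I2) (simp only: norm_mult mult_left_le norm_ge_zero)
  qed (use p q in auto)
  have half: "of_real (a * q) powr p *
           (exp (\<sigma> * (of_real pi / 2 * \<i> * p)) * exp (\<sigma> * (\<i> * of_real (a * q))) *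
             upper_inc_Gamma (1 - p) (of_real (a * q) * exp (\<sigma> * (of_real pi / 2 * \<i>)))) =
         of_real q powr p * (rGamma p * I \<sigma>)" if "\<sigma> = 1 \<or> \<sigma> = -1" for \<sigma> :: real
    unfolding upper_inc_Gamma_rotated[OF a q that] gamma_kernel_Fubini[OF p q] I_def ..
  \<comment> \<open>The signs are spelled out as \<open>of_real 1\<close> and
    \<open>of_real (-1)\<close> so that both summands are instances of \<open>half\<close>.\<close>
  have "Pi_term p (of_real (a * q)) =
     (of_real (a * q) powr p *
           (exp (of_real 1 * (of_real pi / 2 * \<i> * p)) * exp (of_real 1 * (\<i> * of_real (a * q))) *
             upper_inc_Gamma (1 - p) (of_real (a * q) * exp (of_real 1 * (of_real pi / 2 * \<i>)))) +
      of_real (a * q) powr p *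
           (exp (of_real (-1) * (of_real pi / 2 * \<i> * p)) * exp (of_real (-1) * (\<i> * of_real (a * q))) *
             upper_inc_Gamma (1 - p) (of_real (a * q) * exp (of_real (-1) * (of_real pi / 2 * \<i>))))) / 2"
    by (simp add: Pi_term_def ring_distribs)
  also have "\<dots> = of_real q powr p * rGamma p * ((I 1 + I (-1)) / 2)"
    by (subst (1 2) half) (simp_all add: ring_distribs)
  also have "I 1 + I (-1) = (\<integral>t. gamma_kernel p (of_real q) t * (1 / (1 + \<i> * of_real (- 1 / a * t))) +
      gamma_kernel p (of_real q) t * (1 / (1 + \<i> * of_real (- (- 1) / a * t))) \<partial>lborel)"
    unfolding I_def by (intro Bochner_Integration.integral_add[symmetric] int)
  also have "\<dots> / 2 = (\<integral>t. gamma_kernel p (of_real q) t * of_real (a\<^sup>2 / (t\<^sup>2 + a\<^sup>2)) \<partial>lborel)"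
    unfolding integral_divide_zero[symmetric]
  proof (intro Bochner_Integration.integral_cong refl)
    fix t :: real
    have "1 / (1 + \<i> * of_real (- 1 / a * t)) + 1 / (1 + \<i> * of_real (- (- 1) / a * t)) =
          2 / ((1 + \<i> * of_real (- 1 / a * t)) * (1 + \<i> * of_real (- (- 1) / a * t)))"
      using nz[of "- 1 / a * t"] nz[of "- (- 1) / a * t"] by (simp add: divide_simps)
    also have "(1 + \<i> * of_real (- 1 / a * t)) * (1 + \<i> * of_real (- (- 1) / a * t)) =
         complex_of_real (1 + (t / a)\<^sup>2)"
      by (simp add: complex_eq_iff power2_eq_square)
    also have "1 + (t / a)\<^sup>2 = (t\<^sup>2 + a\<^sup>2) / a\<^sup>2"
      using a by (simp add: field_simps power_divide)
    finally have eq: "1 / (1 + \<i> * of_real (- 1 / a * t)) + 1 / (1 + \<i> * of_real (- (- 1) / a * t)) =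
        2 * complex_of_real (a\<^sup>2 / (t\<^sup>2 + a\<^sup>2))" by simp
    show "(gamma_kernel p (of_real q) t * (1 / (1 + \<i> * of_real (- 1 / a * t))) +
      gamma_kernel p (of_real q) t * (1 / (1 + \<i> * of_real (- (- 1) / a * t)))) / 2 =
      gamma_kernel p (of_real q) t * of_real (a\<^sup>2 / (t\<^sup>2 + a\<^sup>2))"
      unfolding ring_distribs(1)[symmetric] eq mult.left_commute[of _ 2]
      by (rule nonzero_mult_div_cancel_left) simp
  qed
  finally show ?thesis .
qed

section \<open>Termwise integration over the poles\<close>

lemma tanh_tail_measurable [measurable]: "tanh_tail N \<in> borel_measurable borel"
  unfolding tanh_tail_def[abs_def] by measurable

lemma abs_tanh_tail_le: "\<bar>tanh_tail N t\<bar> \<le> tanh_tail N 0"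
  using tanh_tail_pos[of N t] tanh_tail_le[of N t] by simp

lemma integrable_gamma_kernel_bounded:
  fixes h :: "real \<Rightarrow> complex"
  assumes "Re p > 0" "Re z > 0" and [measurable]: "h \<in> borel_measurable borel" and bound: "\<And>t. norm (h t) \<le> B"
  shows "integrable lborel (\<lambda>t. gamma_kernel p z t * h t)"
proof (rule Bochner_Integration.integrable_bound)
  show "integrable lborel (\<lambda>t. gamma_kernel_real (Re p) (Re z) t * B)"
    using assms by (intro integrable_mult_left integrable_gamma_kernel_real) auto
  have "norm (gamma_kernel p z t * h t) \<le> norm (gamma_kernel_real (Re p) (Re z) t * B)" for t
    unfolding norm_mult norm_gamma_kernel
    by (intro mult_mono) (auto simp: gamma_kernel_real_nonneg intro: order_trans[OF bound abs_ge_self])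
  thus "AE t in lborel. norm (gamma_kernel p z t * h t) \<le> norm (gamma_kernel_real (Re p) (Re z) t * B)"
    by simp
qed auto

text \<open>For real positive \<open>p\<close> this is the unnormalised mean of
  \<open>tanh_tail N\<close> under the Gamma density of shape \<open>p\<close> and rate
  \<open>q\<close>.\<close>

definition weighted_gamma :: "nat \<Rightarrow> real \<Rightarrow> complex \<Rightarrow> complex" where
  "weighted_gamma N q p = (\<integral>t. gamma_kernel p (of_real q) t * of_real (tanh_tail N t) \<partial>lborel)"

text \<open>Integrating the series of \<open>tanh_tail N\<close> termwise gives one Laplace-type
  integral per pole, each a multiple of a value of \<open>Pi_term\<close>.\<close>

lemma Pi_term_sums:
  assumes p: "Re p > 0" and q: "q > 0"
  shows "(\<lambda>k. Pi_term p (of_real (odd_pi k * q)) / of_nat (2 * k + 1) ^ (2 * N + 2)) sums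
           (of_real pi ^ (2 * N + 2) / 4 * (of_real q powr p * rGamma p * weighted_gamma N q p))"
proof -
  define h where "h k t = 4 / (odd_pi k ^ (2 * N) * (t\<^sup>2 + (odd_pi k)\<^sup>2))" for k t
  have h_nonneg: "h k t \<ge> 0" for k t
    using odd_pi_denom_pos[of k N t] by (simp add: h_def)
  have h_le: "h k t \<le> h k 0" for k t
    unfolding h_def by (rule tanh_term_le)
  have [measurable]: "h k \<in> borel_measurable borel" for k
    unfolding h_def[abs_def] by measurable
  have sum_h: "summable (\<lambda>k. h k t)" "(\<Sum>k. h k t) = tanh_tail N t" for t
    unfolding h_def tanh_tail_def by (rule summable_tanh_tail refl)+
  have norm_eq: "norm (gamma_kernel p (of_real q) t * of_real (h k t)) = gamma_kernel_real (Re p) q t * h k t" for k t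
    by (simp add: norm_mult norm_gamma_kernel h_nonneg)
  have int: "integrable lborel (\<lambda>t. gamma_kernel p (of_real q) t * of_real (h k t))" for k
    by (rule integrable_gamma_kernel_bounded[where B = "h k 0"]) (use p q h_le h_nonneg in auto)
  have "(\<lambda>k. \<integral>t. gamma_kernel p (of_real q) t * of_real (h k t) \<partial>lborel) sums
        (\<integral>t. (\<Sum>k. gamma_kernel p (of_real q) t * of_real (h k t)) \<partial>lborel)"
  proof (rule sums_integral)
    show "AE t in lborel. summable (\<lambda>k. norm (gamma_kernel p (of_real q) t * of_real (h k t)))"
      unfolding norm_eq by (intro AE_I2 summable_mult sum_h)
    \<comment> \<open>The terms decrease in \<open>t^2\<close>, so the \<open>k\<close>-th norm
      integral is at most a constant times \<open>h k 0\<close>, which is summable.\<close>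
    show "summable (\<lambda>k. \<integral>t. norm (gamma_kernel p (of_real q) t * of_real (h k t)) \<partial>lborel)"
    proof (rule summable_comparison_test')
      show "summable (\<lambda>k. (\<integral>t. gamma_kernel_real (Re p) q t \<partial>lborel) * h k 0)"
        by (intro summable_mult sum_h)
      fix k
      have "norm (\<integral>t. norm (gamma_kernel p (of_real q) t * of_real (h k t)) \<partial>lborel) =
            (\<integral>t. norm (gamma_kernel p (of_real q) t * of_real (h k t)) \<partial>lborel)"
        by (simp add: integral_nonneg_AE)
      also have "\<dots> \<le> (\<integral>t. gamma_kernel_real (Re p) q t * h k 0 \<partial>lborel)"
        using p q h_le gamma_kernel_real_nonneg
        by (intro integral_mono integrable_norm int integrable_mult_left integrable_gamma_kernel_real)
           (auto simp: norm_eq intro!: mult_left_mono)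
      also have "\<dots> = (\<integral>t. gamma_kernel_real (Re p) q t \<partial>lborel) * h k 0"
        by simp
      finally show "norm (\<integral>t. norm (gamma_kernel p (of_real q) t * of_real (h k t)) \<partial>lborel) \<le>
          (\<integral>t. gamma_kernel_real (Re p) q t \<partial>lborel) * h k 0" .
    qed
  qed (rule int)
  also have "(\<lambda>t. \<Sum>k. gamma_kernel p (of_real q) t * of_real (h k t)) =
             (\<lambda>t. gamma_kernel p (of_real q) t * of_real (tanh_tail N t))"
    by (subst suminf_mult) (simp_all add: summable_of_real sum_h suminf_of_real[symmetric])
  finally have "(\<lambda>k. \<integral>t. gamma_kernel p (of_real q) t * of_real (h k t) \<partial>lborel) sums weighted_gamma N q p"
    by (simp add: weighted_gamma_def)
  hence "(\<lambda>k. of_real pi ^ (2 * N + 2) / 4 * (of_real q powr p * rGamma p *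
            (\<integral>t. gamma_kernel p (of_real q) t * of_real (h k t) \<partial>lborel))) sums
         (of_real pi ^ (2 * N + 2) / 4 * (of_real q powr p * rGamma p * weighted_gamma N q p))"
    by (intro sums_mult)
  also have "(\<lambda>k. of_real pi ^ (2 * N + 2) / 4 * (of_real q powr p * rGamma p *
            (\<integral>t. gamma_kernel p (of_real q) t * of_real (h k t) \<partial>lborel))) =
         (\<lambda>k. Pi_term p (of_real (odd_pi k * q)) / of_nat (2 * k + 1) ^ (2 * N + 2))"
  proof
    fix k
    \<comment> \<open>This relates the integrand of \<open>Pi_term\<close> to the term
      \<open>h k t\<close>; the power of \<open>odd_pi k\<close> later splits into powers of
      \<open>2 * k + 1\<close> and \<open>pi\<close>.\<close>
    have "(odd_pi k)\<^sup>2 / (t\<^sup>2 + (odd_pi k)\<^sup>2) = h k t * (odd_pi k ^ (2 * N + 2) / 4)" for t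
    proof -
      have *: "x / S = 4 / (A * S) * (A * x / 4)" if "A \<noteq> 0" "S \<noteq> 0" for A S x :: real
        using that by simp
      have "t\<^sup>2 + (odd_pi k)\<^sup>2 \<noteq> 0"
        using add_nonneg_pos[of "t\<^sup>2" "(odd_pi k)\<^sup>2"] by simp
      thus ?thesis
        unfolding h_def power_add by (intro *) simp_all
    qed
    hence "Pi_term p (of_real (odd_pi k * q)) = of_real q powr p * rGamma p *
        ((\<integral>t. gamma_kernel p (of_real q) t * of_real (h k t) \<partial>lborel) * of_real (odd_pi k ^ (2 * N + 2) / 4))"
      unfolding Pi_term_Laplace[OF p odd_pi_pos q]
      by (simp only: of_real_mult mult.assoc[symmetric] integral_mult_left_zero)
    moreover have "complex_of_real (odd_pi k ^ (2 * N + 2) / 4) =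
        of_nat (2 * k + 1) ^ (2 * N + 2) * (of_real pi ^ (2 * N + 2) / 4)"
    proof -
      have "odd_pi k = real (2 * k + 1) * pi"
        by (simp add: odd_pi_def)
      hence "odd_pi k ^ (2 * N + 2) / 4 = real (2 * k + 1) ^ (2 * N + 2) * (pi ^ (2 * N + 2) / 4)"
        by (simp only: power_mult_distrib times_divide_eq_right)
      thus ?thesis
        by (simp only: of_real_mult of_real_power of_real_of_nat_eq of_real_divide of_real_numeral)
    qed
    moreover have "(of_nat (2 * k + 1) :: complex) ^ (2 * N + 2) \<noteq> 0"
      by (simp only: power_eq_0_iff of_nat_eq_0_iff) simp
    ultimately show "of_real pi ^ (2 * N + 2) / 4 * (of_real q powr p * rGamma p *
            (\<integral>t. gamma_kernel p (of_real q) t * of_real (h k t) \<partial>lborel)) =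
        Pi_term p (of_real (odd_pi k * q)) / of_nat (2 * k + 1) ^ (2 * N + 2)"
      by (simp only: nonzero_eq_divide_eq not_False_eq_True mult_ac)
  qed
  finally show ?thesis .
qed

section \<open>Analytic continuation of the alternating zeta function\<close>

lemma gamma_kernel_times_power:
  "gamma_kernel p z t * of_real (t ^ m) = gamma_kernel (p + of_nat m) z t"
proof (cases "t > 0")
  case True
  have "complex_of_real (t ^ m) = exp (of_nat m * of_real (ln t))"
    using True by (simp add: exp_of_nat_mult exp_of_real)
  with True show ?thesis
    by (simp add: gamma_kernel_def algebra_simps flip: exp_add)
qed (simp add: gamma_kernel_def)

text \<open>The moment shifts the Gamma argument from \<open>s\<close> to \<open>s + m\<close>, and
  \<open>Gamma (s + m) / Gamma s\<close> is the Pochhammer symbol.\<close>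

lemma gamma_kernel_moment:
  assumes "Re s > 0" "q > 0"
  shows "rGamma s * (\<integral>t. gamma_kernel s (of_real q) t * of_real (t ^ m) \<partial>lborel) =
         of_real q powr (-s) * (pochhammer s m / of_real q ^ m)"
proof -
  have "Re (s + of_nat m) > 0"
    using assms by simp
  hence "rGamma (s + of_nat m) * Gamma (s + of_nat m) = 1"
    using Gamma_complex_nonzero_right_halfplane by (simp add: rGamma_inverse_Gamma)
  moreover have "of_real q powr (- (s + of_nat m)) = complex_of_real q powr (-s) / of_real q ^ m"
    using assms by (simp add: powr_diff powr_nat)
  ultimately show ?thesis
    using assms unfolding gamma_kernel_times_power pochhammer_rGamma[of s m]
    by (simp add: integral_gamma_kernel del: minus_add_distrib)
qed

lemma integrable_gamma_kernel_power:
  assumes "Re s > 0" "q > 0"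
  shows "integrable lborel (\<lambda>t. gamma_kernel s (of_real q) t * of_real (t ^ m))"
  unfolding gamma_kernel_times_power using assms by (intro integrable_gamma_kernel) auto

text \<open>
  The truncated geometric series \<open>\<Sum>n<M. (-1)\<^sup>n e\<^sup>-\<^sup>n\<^sup>t\<close> misses \<open>1 / (1 + e\<^sup>-\<^sup>t)\<close> by at most \<open>e\<^sup>-\<^sup>M\<^sup>t\<close>,
  which yields convergence in the whole half-plane \<open>Re s > 0\<close>, also where it is only conditional.
\<close>

lemma alternating_series_Mellin:
  assumes s: "Re s > 0" and q: "q > 0"
  shows "(\<lambda>n. (-1) ^ n / (of_nat n + of_real q) powr s) sums
           (rGamma s * (\<integral>t. gamma_kernel s (of_real q) t * of_real (1 / (1 + exp (-t))) \<partial>lborel))"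
proof -
  define A where "A = (\<integral>t. gamma_kernel s (of_real q) t * of_real (1 / (1 + exp (-t))) \<partial>lborel)"
  define K where "K n = gamma_kernel s (of_real (q + real n))" for n
  have K_int: "integrable lborel (K n)" for n
    unfolding K_def using assms by (intro integrable_gamma_kernel) auto
  have frac: "0 \<le> 1 / (1 + exp (-t))" "1 / (1 + exp (-t)) \<le> 1" for t :: real
    using exp_gt_zero[of "-t"] by (auto simp: divide_simps add_pos_pos)
  have frac_norm: "norm (complex_of_real (1 / (1 + exp (-t)))) \<le> 1" for t :: real
    unfolding norm_of_real abs_of_nonneg[OF frac(1)] by (rule frac(2))
  have frac_int: "integrable lborel (\<lambda>t. K n t * of_real (1 / (1 + exp (-t))))" for n
    unfolding K_def using assms by (intro integrable_gamma_kernel_bounded[where B = 1] frac_norm) auto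
  have K_exp: "K n t = gamma_kernel s (of_real q) t * of_real (exp (-t) ^ n)" for n t
    unfolding K_def of_real_add gamma_kernel_shift_arg[symmetric]
    by (simp add: exp_of_nat_mult[symmetric] exp_of_real[symmetric])
  have term_eq: "(-1) ^ n / (of_nat n + of_real q) powr s = rGamma s * ((-1) ^ n * (\<integral>t. K n t \<partial>lborel))" for n
    using s q Gamma_complex_nonzero_right_halfplane[OF s]
    unfolding K_def by (subst integral_gamma_kernel) (auto simp: rGamma_inverse_Gamma powr_minus field_simps)
  \<comment> \<open>The geometric remainder is exact: with \<open>x = exp (-t)\<close>, each step
    uses \<open>1 / (1 + x) - 1 = - x / (1 + x)\<close>.\<close>
  have partial: "A - (\<Sum>n<M. (-1) ^ n * (\<integral>t. K n t \<partial>lborel)) =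
      (-1) ^ M * (\<integral>t. K M t * of_real (1 / (1 + exp (-t))) \<partial>lborel)" for M
  proof (induction M)
    case 0
    show ?case by (simp add: A_def K_def)
  next
    case (Suc M)
    have "K M t * of_real (1 / (1 + exp (-t))) - K M t = - (K (Suc M) t * of_real (1 / (1 + exp (-t))))" for t
    proof -
      have "1 / (1 + exp (-t)) - 1 = - (exp (-t) * (1 / (1 + exp (-t))))"
        using exp_gt_zero[of "-t"] by (simp add: field_simps add_pos_pos less_imp_neq[symmetric])
      hence "K M t * of_real (1 / (1 + exp (-t)) - 1) = - (K M t * of_real (exp (-t)) * of_real (1 / (1 + exp (-t))))"
        by (simp only: of_real_minus of_real_mult mult_minus_right mult.assoc)
      thus ?thesis
        by (simp add: K_exp algebra_simps)
    qed
    hence "(\<integral>t. K M t * of_real (1 / (1 + exp (-t))) \<partial>lborel) - (\<integral>t. K M t \<partial>lborel) =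
        - (\<integral>t. K (Suc M) t * of_real (1 / (1 + exp (-t))) \<partial>lborel)"
      by (subst Bochner_Integration.integral_diff[OF frac_int K_int, symmetric]) simp
    hence "(-1) ^ M * (\<integral>t. K M t * of_real (1 / (1 + exp (-t))) \<partial>lborel) - (-1) ^ M * (\<integral>t. K M t \<partial>lborel) =
        (-1) ^ Suc M * (\<integral>t. K (Suc M) t * of_real (1 / (1 + exp (-t))) \<partial>lborel)"
      by (simp flip: right_diff_distrib)
    with Suc.IH show ?case
      by (simp add: algebra_simps)
  qed
  have "(\<lambda>M. A - (\<Sum>n<M. (-1) ^ n * (\<integral>t. K n t \<partial>lborel))) \<longlonglongrightarrow> 0"
    unfolding partial
  proof (rule Lim_null_comparison)
    \<comment> \<open>Bounding the fraction by 1 leaves a Gamma integral with rate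
      \<open>q + M\<close>, which tends to 0 because \<open>Re s > 0\<close>.\<close>
    show "\<forall>\<^sub>F M in sequentially. norm ((-1) ^ M * (\<integral>t. K M t * of_real (1 / (1 + exp (-t))) \<partial>lborel))
        \<le> Gamma (Re s) * (q + real M) powr (- Re s)"
    proof (intro always_eventually allI)
      fix M
      have "norm ((-1) ^ M * (\<integral>t. K M t * of_real (1 / (1 + exp (-t))) \<partial>lborel)) \<le>
            (\<integral>t. gamma_kernel_real (Re s) (q + real M) t \<partial>lborel)"
        unfolding norm_mult norm_power norm_minus_cancel norm_one power_one mult_1_left
      proof (rule Bochner_Integration.integral_norm_bound_integral[OF frac_int integrable_gamma_kernel_real])
        fix t
        show "norm (K M t * of_real (1 / (1 + exp (-t)))) \<le> gamma_kernel_real (Re s) (q + real M) t"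
          unfolding norm_mult K_def norm_gamma_kernel norm_of_real
          unfolding abs_of_nonneg[OF frac(1)] of_real_add[symmetric] Re_complex_of_real
          by (intro mult_left_le frac gamma_kernel_real_nonneg)
      qed (use s q in auto)
      also have "\<dots> = Gamma (Re s) * (q + real M) powr (- Re s)"
        using s q by (intro integral_gamma_kernel_real) auto
      finally show "norm ((-1) ^ M * (\<integral>t. K M t * of_real (1 / (1 + exp (-t))) \<partial>lborel))
        \<le> Gamma (Re s) * (q + real M) powr (- Re s)" .
    qed
    have "filterlim (\<lambda>M. q + real M) at_top sequentially"
      by (intro filterlim_tendsto_add_at_top[OF tendsto_const] filterlim_real_sequentially)
    thus "(\<lambda>M. Gamma (Re s) * (q + real M) powr (- Re s)) \<longlonglongrightarrow> 0"
      using s by (intro tendsto_mult_right_zero tendsto_neg_powr) auto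
  qed
  hence "(\<lambda>M. A - (A - (\<Sum>n<M. (-1) ^ n * (\<integral>t. K n t \<partial>lborel)))) \<longlonglongrightarrow> A - 0"
    by (intro tendsto_diff tendsto_const)
  hence "(\<lambda>n. (-1) ^ n * (\<integral>t. K n t \<partial>lborel)) sums A"
    by (simp add: sums_def)
  thus ?thesis
    unfolding term_eq A_def[symmetric] by (rule sums_mult)
qed

text \<open>The explicit candidate for the remainder. The entire function \<open>rGamma\<close>
  replaces division by \<open>Gamma\<close>, so nonpositive integers \<open>s\<close> cause no
  singularity.\<close>

definition remainder_function :: "nat \<Rightarrow> real \<Rightarrow> complex \<Rightarrow> complex" where
  "remainder_function N q s =
     (-1) ^ (N + 1) * of_real q powr s * rGamma s * weighted_gamma N q (s + of_nat (2 * N + 1))"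

text \<open>The right-hand side of the equality that defines the remainder, with the explicit
  candidate inserted.\<close>

definition truncated_zeta :: "nat \<Rightarrow> real \<Rightarrow> complex \<Rightarrow> complex" where
  "truncated_zeta N q s = 1 / 2 * of_real q powr (- s) - 1 / 2 * of_real q powr (- s) *
     ((\<Sum>k<N. euler_poly (2 * k + 1) 0 / fact (2 * k + 1) *
               (pochhammer s (2 * k + 1) / of_real q ^ (2 * k + 1))) + remainder_function N q s)"

text \<open>In the Mellin integral of the series,
  \<open>1 / (1 + exp (-t)) = 1/2 + tanh (t / 2) / 2\<close> is expanded by
  \<open>tanh_expansion\<close>: the powers of \<open>t\<close> become moments and the tail becomes
  \<open>weighted_gamma\<close>.\<close>

lemma truncated_zeta_sums:
  assumes s: "Re s > 0" and q: "q > 0"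
  shows "(\<lambda>n. (-1) ^ n / (of_nat n + of_real q) powr s) sums truncated_zeta N q s"
proof -
  let ?K = "gamma_kernel s (of_real q)"
  have logistic: "1 / (1 + exp (-t)) = 1 / 2 * t ^ 0 + ((\<Sum>k<N. (-1) ^ k * tanh_tail k 0 / 2 * t ^ (2 * k + 1)) +
      (-1) ^ N / 2 * (t ^ (2 * N + 1) * tanh_tail N t))" for t
  proof -
    have "1 / (1 + exp (-t)) = 1 / 2 + tanh (t / 2) / 2"
      using add_pos_pos[OF zero_less_one exp_gt_zero[of "-t"]]
      by (simp add: tanh_real_altdef field_simps)
    thus ?thesis
      by (simp add: tanh_expansion[of t N] sum_divide_distrib add_divide_distrib mult.assoc)
  qed
  \<comment> \<open>The power of \<open>t\<close> is absorbed into the kernel, whose parameter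
    becomes \<open>s + 2 * N + 1\<close>; the bounded factor \<open>tanh_tail N\<close>
    remains.\<close>
  have int_tail: "integrable lborel (\<lambda>t. ?K t * of_real (t ^ (2 * N + 1) * tanh_tail N t))"
    unfolding of_real_mult mult.assoc[symmetric] gamma_kernel_times_power
    using assms by (intro integrable_gamma_kernel_bounded[where B = "tanh_tail N 0"]) (auto simp: abs_tanh_tail_le)
  have linear: "(\<integral>t. 1 / 2 * f 0 t + ((\<Sum>k<N. c k * f (2 * k + 1) t) + d * g t) \<partial>lborel) =
      1 / 2 * (\<integral>t. f 0 t \<partial>lborel) + ((\<Sum>k<N. c k * (\<integral>t. f (2 * k + 1) t \<partial>lborel)) + d * (\<integral>t. g t \<partial>lborel))"
    if "\<And>m. integrable lborel (f m)" "integrable lborel g"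
    for f :: "nat \<Rightarrow> real \<Rightarrow> complex" and g c d
    using that by simp
  have "(\<integral>t. ?K t * of_real (1 / (1 + exp (-t))) \<partial>lborel) =
    (\<integral>t. 1 / 2 * (?K t * of_real (t ^ 0)) + ((\<Sum>k<N. of_real ((-1) ^ k * tanh_tail k 0 / 2) * (?K t * of_real (t ^ (2 * k + 1)))) +
      (-1) ^ N / 2 * (?K t * of_real (t ^ (2 * N + 1) * tanh_tail N t))) \<partial>lborel)"
    unfolding logistic by (intro Bochner_Integration.integral_cong refl)
      (simp add: ring_distribs sum_distrib_left mult_ac)
  also have "\<dots> = 1 / 2 * (\<integral>t. ?K t * of_real (t ^ 0) \<partial>lborel) +
      ((\<Sum>k<N. of_real ((-1) ^ k * tanh_tail k 0 / 2) * (\<integral>t. ?K t * of_real (t ^ (2 * k + 1)) \<partial>lborel)) +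
      (-1) ^ N / 2 * (\<integral>t. ?K t * of_real (t ^ (2 * N + 1) * tanh_tail N t) \<partial>lborel))"
    by (rule linear[of "\<lambda>m t. ?K t * of_real (t ^ m)"]) (rule integrable_gamma_kernel_power[OF s q] int_tail)+
  also have "(\<integral>t. ?K t * of_real (t ^ (2 * N + 1) * tanh_tail N t) \<partial>lborel) =
      weighted_gamma N q (s + of_nat (2 * N + 1))"
    unfolding of_real_mult mult.assoc[symmetric] gamma_kernel_times_power weighted_gamma_def ..
  finally have "rGamma s * (\<integral>t. ?K t * of_real (1 / (1 + exp (-t))) \<partial>lborel) =
     1 / 2 * (rGamma s * (\<integral>t. ?K t * of_real (t ^ 0) \<partial>lborel)) +
      ((\<Sum>k<N. of_real ((-1) ^ k * tanh_tail k 0 / 2) * (rGamma s * (\<integral>t. ?K t * of_real (t ^ (2 * k + 1)) \<partial>lborel))) +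
      (-1) ^ N / 2 * (rGamma s * weighted_gamma N q (s + of_nat (2 * N + 1))))"
    by (simp only: ring_distribs sum_distrib_left mult.left_commute[of "rGamma s"])
  also have "\<dots> = 1 / 2 * of_real q powr (-s) +
      ((\<Sum>k<N. of_real ((-1) ^ k * tanh_tail k 0 / 2) * (of_real q powr (-s) * (pochhammer s (2 * k + 1) / of_real q ^ (2 * k + 1)))) +
      (-1) ^ N / 2 * (rGamma s * weighted_gamma N q (s + of_nat (2 * N + 1))))"
    unfolding gamma_kernel_moment[OF s q] by simp
  also have "(-1) ^ N / 2 * (rGamma s * weighted_gamma N q (s + of_nat (2 * N + 1))) =
      - (1 / 2 * of_real q powr (-s) * remainder_function N q s)"
  proof -
    have "of_real q powr (-s) * of_real q powr s = 1"
      using q by (simp flip: powr_add)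
    hence "of_real q powr (-s) * remainder_function N q s = (-1) ^ (N + 1) * rGamma s * weighted_gamma N q (s + of_nat (2 * N + 1))"
      unfolding remainder_function_def mult.left_commute[of "(-1) ^ (N + 1)"] mult.assoc
      by (simp add: mult.assoc[symmetric])
    thus ?thesis by (simp add: mult.assoc)
  qed
  also have "(\<Sum>k<N. of_real ((-1) ^ k * tanh_tail k 0 / 2) * (of_real q powr (-s) * (pochhammer s (2 * k + 1) / of_real q ^ (2 * k + 1)))) =
      - (1 / 2 * of_real q powr (- s) * (\<Sum>k<N. euler_poly (2 * k + 1) 0 / fact (2 * k + 1) *
               (pochhammer s (2 * k + 1) / of_real q ^ (2 * k + 1))))"
    unfolding euler_poly_odd_at_0 sum_distrib_left sum_negf[symmetric]
    by (intro sum.cong refl) simp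
  also have "1 / 2 * of_real q powr (-s) +
      (- (1 / 2 * of_real q powr (- s) * (\<Sum>k<N. euler_poly (2 * k + 1) 0 / fact (2 * k + 1) *
               (pochhammer s (2 * k + 1) / of_real q ^ (2 * k + 1)))) +
       - (1 / 2 * of_real q powr (-s) * remainder_function N q s)) = truncated_zeta N q s"
    unfolding truncated_zeta_def by (simp only: distrib_left diff_conv_add_uminus minus_add_distrib)
  finally show ?thesis
    using alternating_series_Mellin[OF assms] by simp
qed

text \<open>The half-plane is where the shifted argument \<open>s + 2 * N + 1\<close> of
  \<open>weighted_gamma\<close> has positive real part; the other factors are entire in
  \<open>s\<close>.\<close>

lemma holomorphic_truncated_zeta:
  assumes q: "q > 0"
  shows "truncated_zeta N q holomorphic_on {s. Re s > - 2 * real N - 1}"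
proof -
  have "weighted_gamma N q holomorphic_on {p. Re p > 0}"
    unfolding weighted_gamma_def using q
    by (intro holomorphic_weighted_gamma_kernel[where B = "tanh_tail N 0"]) (auto simp: abs_tanh_tail_le)
  hence "(weighted_gamma N q \<circ> (\<lambda>s. s + of_nat (2 * N + 1))) holomorphic_on {s. Re s > - 2 * real N - 1}"
    by (rule holomorphic_on_compose_gen[rotated]) (auto intro!: holomorphic_intros)
  hence [holomorphic_intros]: "(\<lambda>s. weighted_gamma N q (s + of_nat (2 * N + 1))) holomorphic_on {s. Re s > - 2 * real N - 1}"
    by (simp add: o_def)
  show ?thesis
    unfolding truncated_zeta_def remainder_function_def pochhammer_prod using q
    by (intro holomorphic_intros) auto
qed

text \<open>For positive real arguments both are sums of the same series, and the identity theorem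
  extends the equality to the common half-plane.\<close>

lemma truncated_zeta_eq:
  assumes "q > 0" "Re s > - 2 * real M - 1" "Re s > - 2 * real N - 1"
  shows "truncated_zeta M q s = truncated_zeta N q s"
proof (rule holomorphic_halfplane_eqI[of "truncated_zeta M q" "max (- 2 * real M - 1) (- 2 * real N - 1)" "truncated_zeta N q" 0])
  show "truncated_zeta M q (of_real x) = truncated_zeta N q (of_real x)" if "x > 0" for x
    by (rule sums_unique2[OF truncated_zeta_sums truncated_zeta_sums]) (use assms(1) that in auto)
  show "truncated_zeta M q holomorphic_on {z. Re z > max (- 2 * real M - 1) (- 2 * real N - 1)}"
    by (rule holomorphic_on_subset[OF holomorphic_truncated_zeta[OF assms(1)]]) auto
  show "truncated_zeta N q holomorphic_on {z. Re z > max (- 2 * real M - 1) (- 2 * real N - 1)}"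
    by (rule holomorphic_on_subset[OF holomorphic_truncated_zeta[OF assms(1)]]) auto
  show "Re s > max (- 2 * real M - 1) (- 2 * real N - 1)"
    using assms by simp
qed

text \<open>Gluing the truncations of all orders yields an entire function that sums the series, and
  the identity theorem makes it the only one.\<close>

lemma alt_hurwitz_zeta_eq_truncated:
  assumes q: "q > 0" and s: "Re s > - 2 * real N - 1"
  shows "alt_hurwitz_zeta s (of_real q) = truncated_zeta N q s"
proof -
  \<comment> \<open>This order puts \<open>s\<close> into the half-plane of its own truncation; by
    \<open>truncated_zeta_eq\<close> any other admissible order gives the same value.\<close>
  define M where "M s = nat \<lceil>\<bar>Re s\<bar>\<rceil>" for s
  define f where "f s = truncated_zeta (M s) q s" for s
  have M: "Re s > - 2 * real (M s) - 1" for s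
    unfolding M_def by linarith
  have f_eq: "f s = truncated_zeta N q s" if "Re s > - 2 * real N - 1" for s N
    unfolding f_def by (rule truncated_zeta_eq[OF q M that])
  have f: "f holomorphic_on UNIV \<and>
        (\<forall>z. Re z > 0 \<longrightarrow> (\<lambda>n. (-1) ^ n / (of_nat n + of_real q) powr z) sums f z)"
  proof (intro conjI allI impI)
    show "f holomorphic_on UNIV"
      unfolding holomorphic_on_def
    proof
      fix s
      \<comment> \<open>On the open set \<open>S\<close> around \<open>s\<close> the glued function
        equals one fixed truncation.\<close>
      define S where "S = {z. Re z > - 2 * real (M s) - 1}"
      have "f holomorphic_on S"
        using holomorphic_truncated_zeta[OF q, of "M s"] f_eq[of "M s"]
        unfolding S_def by (subst holomorphic_cong[OF refl]) auto
      moreover have "open S" "s \<in> S"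
        using M[of s] by (auto simp: S_def open_halfspace_Re_gt)
      ultimately show "f field_differentiable at s within UNIV"
        using holomorphic_on_imp_differentiable_at by simp
    qed
    show "(\<lambda>n. (-1) ^ n / (of_nat n + of_real q) powr z) sums f z" if "Re z > 0" for z
      unfolding f_def by (rule truncated_zeta_sums[OF that q])
  qed
  have "(THE f. f holomorphic_on UNIV \<and>
             (\<forall>z. Re z > 0 \<longrightarrow> (\<lambda>n. (-1) ^ n / (of_nat n + of_real q) powr z) sums f z)) = f"
  proof (rule the_equality, rule f)
    fix g assume g: "g holomorphic_on UNIV \<and>
             (\<forall>z. Re z > 0 \<longrightarrow> (\<lambda>n. (-1) ^ n / (of_nat n + of_real q) powr z) sums g z)"
    show "g = f"
    proof
      fix z
      show "g z = f z"
      proof (rule holomorphic_halfplane_eqI[of g "Re z - 1" f 0])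
        show "g (of_real x) = f (of_real x)" if "x > 0" for x
          using f g that sums_unique2[of "\<lambda>n. (-1) ^ n / (of_nat n + complex_of_real q) powr of_real x"] by auto
      qed (use f g in \<open>auto intro: holomorphic_on_subset\<close>)
    qed
  qed
  thus ?thesis
    unfolding alt_hurwitz_zeta_def using f_eq[OF s] by simp
qed

text \<open>The factor \<open>q powr (-s)\<close> is nonzero, so the defining equality determines
  the remainder. Then \<open>rGamma s = pochhammer s n * rGamma (s + n)\<close> with
  \<open>n = 2 * N + 1\<close> brings out the Pochhammer factor, also where \<open>Gamma\<close> has
  poles.\<close>

lemma alt_zeta_remainder_eq:
  assumes q: "q > 0" and s: "Re s > - 2 * real N - 1"
  shows "alt_zeta_remainder N s (of_real q) =
    (-1) ^ (N + 1) * (pochhammer s (2 * N + 1) / of_real q ^ (2 * N + 1)) *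
      (of_real q powr (s + of_nat (2 * N + 1)) * rGamma (s + of_nat (2 * N + 1)) *
       weighted_gamma N q (s + of_nat (2 * N + 1)))"
proof -
  have nz: "complex_of_real q powr (-s) \<noteq> 0"
    using q by simp
  have "alt_zeta_remainder N s (of_real q) = remainder_function N q s"
    using alt_hurwitz_zeta_conv_remainder[of "of_real q" s N] alt_hurwitz_zeta_eq_truncated[OF q s] q nz
    unfolding truncated_zeta_def by simp
  also have "\<dots> = (-1) ^ (N + 1) * (pochhammer s (2 * N + 1) / of_real q ^ (2 * N + 1)) *
      (of_real q powr (s + of_nat (2 * N + 1)) * rGamma (s + of_nat (2 * N + 1)) *
       weighted_gamma N q (s + of_nat (2 * N + 1)))"
  proof -
    have "of_real q powr (s + of_nat (2 * N + 1)) = complex_of_real q powr s * of_real q ^ (2 * N + 1)"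
      using q unfolding powr_add by (subst powr_nat) auto
    thus ?thesis
      unfolding remainder_function_def pochhammer_rGamma[of s "2 * N + 1"] using q
      by (simp add: field_simps)
  qed
  finally show ?thesis .
qed

section \<open>Series and size of the remainder\<close>

text \<open>The normalising factors turn \<open>weighted_gamma\<close> into a mean over a Gamma
  density, and \<open>tanh_tail N t\<close> lies strictly between 0 and \<open>tanh_tail N 0\<close>
  for \<open>t > 0\<close>.\<close>

lemma weighted_gamma_mean:
  assumes a: "a > 0" and q: "q > 0"
  shows "\<exists>\<theta>::real. 0 < \<theta> \<and> \<theta> < 1 \<and>
           of_real q powr (of_real a) * rGamma (of_real a) * weighted_gamma N q (of_real a) =
           of_real (tanh_tail N 0 * \<theta>)"
proof -
  define G where "G = (\<integral>t. gamma_kernel_real a q t * tanh_tail N t \<partial>lborel)"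
  define T where "T = tanh_tail N 0"
  have T: "T > 0" unfolding T_def by (rule tanh_tail_pos)
  have Gam: "Gamma a > 0"
    using a by (rule Gamma_real_pos)
  have int0: "integrable lborel (\<lambda>t. gamma_kernel_real a q t * T)"
    using a q by (intro integrable_mult_left integrable_gamma_kernel_real) auto
  have int: "integrable lborel (\<lambda>t. gamma_kernel_real a q t * tanh_tail N t)"
  proof (rule Bochner_Integration.integrable_bound[OF int0])
    show "AE t in lborel. norm (gamma_kernel_real a q t * tanh_tail N t) \<le> norm (gamma_kernel_real a q t * T)"
      using abs_tanh_tail_le[of N] T unfolding T_def
      by (intro AE_I2) (auto simp: abs_mult intro!: mult_left_mono)
  qed auto
  \<comment> \<open>Strictness survives integration: a zero integral would force \<open>f\<close> to
    vanish almost everywhere, although it is positive on the unit interval.\<close>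
  have pos: "(\<integral>t. f t \<partial>lborel) > 0"
    if f: "integrable lborel f" "\<And>t. f t \<ge> 0" "\<And>t. t > 0 \<Longrightarrow> f t > 0" for f :: "real \<Rightarrow> real"
  proof -
    have "(\<integral>t. f t \<partial>lborel) \<noteq> 0"
    proof
      assume "(\<integral>t. f t \<partial>lborel) = 0"
      hence "AE t in lborel. f t = 0"
        using f by (subst (asm) integral_nonneg_eq_0_iff_AE) auto
      hence "AE t in lborel. t \<notin> {0<..<1::real}"
        by eventually_elim (use f(3) in force)
      hence "emeasure lborel {0<..<1::real} = 0"
        by (subst (asm) AE_iff_measurable[where N = "{0<..<1}"]) auto
      thus False by simp
    qed
    moreover have "(\<integral>t. f t \<partial>lborel) \<ge> 0"
      using f by (intro integral_nonneg_AE) auto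
    ultimately show ?thesis by simp
  qed
  have G_pos: "G > 0"
    unfolding G_def using int tanh_tail_pos[of N] 
    by (intro pos) (auto simp: gamma_kernel_real_def less_imp_le)
  have "(\<integral>t. gamma_kernel_real a q t * T - gamma_kernel_real a q t * tanh_tail N t \<partial>lborel) > 0"
  proof (rule pos)
    fix t :: real
    show "gamma_kernel_real a q t * T - gamma_kernel_real a q t * tanh_tail N t \<ge> 0"
      using tanh_tail_le[of N t] gamma_kernel_real_nonneg[of a q t] unfolding T_def by (simp add: mult_left_mono)
    show "gamma_kernel_real a q t * T - gamma_kernel_real a q t * tanh_tail N t > 0" if "t > 0"
      using tanh_tail_less[of t N] that unfolding T_def by (simp add: gamma_kernel_real_def)
  qed (use int0 int in auto)
  hence "G < Gamma a * q powr (-a) * T"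
    using integral_gamma_kernel_real[OF a q] int0 int by (simp add: G_def)
  hence G_less: "q powr a / Gamma a * G < T"
    using Gam q by (simp add: powr_minus field_simps)
  have "weighted_gamma N q (of_real a) = of_real G"
    unfolding weighted_gamma_def G_def gamma_kernel_of_real of_real_mult[symmetric] integral_complex_of_real ..
  hence "of_real q powr (of_real a) * rGamma (of_real a) * weighted_gamma N q (of_real a) =
      of_real (q powr a / Gamma a * G)"
    using q by (simp add: rGamma_inverse_Gamma Gamma_complex_of_real powr_of_real divide_inverse)
  also have "q powr a / Gamma a * G = T * (q powr a / Gamma a * G / T)"
    using T by simp
  finally have eq: "of_real q powr (of_real a) * rGamma (of_real a) * weighted_gamma N q (of_real a) =
      complex_of_real (T * (q powr a / Gamma a * G / T))" .
  show ?thesis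
  proof (intro exI conjI)
    \<comment> \<open>The witness is the Gamma mean of \<open>tanh_tail N\<close> divided by its
      maximum \<open>T\<close>.\<close>
    show "0 < q powr a / Gamma a * G / T"
      using q Gam G_pos T by simp
    show "q powr a / Gamma a * G / T < 1"
      unfolding pos_divide_less_eq[OF T] using G_less by simp
    show "of_real q powr (of_real a) * rGamma (of_real a) * weighted_gamma N q (of_real a) =
           complex_of_real (tanh_tail N 0 * (q powr a / Gamma a * G / T))"
      using eq unfolding T_def .
  qed
qed

theorem theorem3p6:
  fixes N :: nat and q s :: real
  assumes "N \<ge> 1" and "q > 0" and "s \<noteq> 1" and "s > - 2 * real N - 1"
  shows "summable (\<lambda>k. Pi_term (of_real (s + 2 * real N + 1)) (of_real ((2 * real k + 1) * pi * q)) /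
                         of_nat (2 * k + 1) ^ (2 * N + 2)) \<and>
         alt_zeta_remainder N (of_real s) (of_real q) =
           (-1) ^ (N + 1) * 4 *
           (pochhammer (of_real s) (2 * N + 1) / (of_real pi ^ (2 * N + 2) * of_real q ^ (2 * N + 1))) *
           (\<Sum>k. Pi_term (of_real (s + 2 * real N + 1)) (of_real ((2 * real k + 1) * pi * q)) /
                  of_nat (2 * k + 1) ^ (2 * N + 2)) \<and>
         (\<exists>\<theta>::real. 0 < \<theta> \<and> \<theta> < 1 \<and>
           alt_zeta_remainder N (of_real s) (of_real q) =
             euler_poly (2 * N + 1) 0 / fact (2 * N + 1) *
             (pochhammer (of_real s) (2 * N + 1) / of_real q ^ (2 * N + 1)) * of_real \<theta>)"
proof -
  note q = assms(2)
  define p where "p = s + 2 * real N + 1"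
  define P where "P = pochhammer (complex_of_real s) (2 * N + 1)"
  define W where "W = of_real q powr (of_real p) * rGamma (of_real p) * weighted_gamma N q (of_real p)"
  have p: "p > 0" using assms by (simp add: p_def)
  have p_eq: "complex_of_real s + of_nat (2 * N + 1) = of_real p"
    by (simp add: p_def)
  have sums: "(\<lambda>k. Pi_term (of_real p) (of_real ((2 * real k + 1) * pi * q)) / of_nat (2 * k + 1) ^ (2 * N + 2)) sums
      (of_real pi ^ (2 * N + 2) / 4 * W)"
    using Pi_term_sums[of "of_real p" q N] p q unfolding odd_pi_def W_def by simp
  have R: "alt_zeta_remainder N (of_real s) (of_real q) = (-1) ^ (N + 1) * (P / of_real q ^ (2 * N + 1)) * W"
    using alt_zeta_remainder_eq[OF q, of N "of_real s"] assms unfolding p_eq P_def W_def by simp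
  obtain \<theta> :: real where \<theta>: "0 < \<theta>" "\<theta> < 1" "W = of_real (tanh_tail N 0 * \<theta>)"
    using weighted_gamma_mean[OF p q, of N] unfolding W_def by auto
  show ?thesis
    unfolding p_def[symmetric] P_def[symmetric] sums_unique[OF sums, symmetric] R
  proof (intro conjI exI[of _ \<theta>] \<theta>(1,2))
    show "summable (\<lambda>k. Pi_term (of_real p) (of_real ((2 * real k + 1) * pi * q)) / of_nat (2 * k + 1) ^ (2 * N + 2))"
      using sums by (rule sums_summable)
    \<comment> \<open>Used with \<open>c = pi ^ (2 * N + 2)\<close>, the normalisation of the sum of
      the \<open>Pi_term\<close> series.\<close>
    have "a * (P / b) * W = a * 4 * (P / (c * b)) * (c / 4 * W)" if "c \<noteq> 0" for a b c
      using that by simp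
    thus "(-1) ^ (N + 1) * (P / of_real q ^ (2 * N + 1)) * W =
        (-1) ^ (N + 1) * 4 * (P / (of_real pi ^ (2 * N + 2) * of_real q ^ (2 * N + 1))) *
        (of_real pi ^ (2 * N + 2) / 4 * W)"
      by simp
    show "(-1) ^ (N + 1) * (P / of_real q ^ (2 * N + 1)) * W =
        euler_poly (2 * N + 1) 0 / fact (2 * N + 1) * (P / of_real q ^ (2 * N + 1)) * of_real \<theta>"
      \<comment> \<open>The Euler coefficient is \<open>(-1) ^ (N + 1) * tanh_tail N 0\<close>, so
        the signs on both sides agree.\<close>
      unfolding euler_poly_odd_at_0 \<theta>(3) by simp
  qed
qed

end
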